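(* Let $n\ge2$, let $\Omega\subset\mathbb{R}^n$ be a bounded strictly convex domain with smooth boundary $\partial\Omega$, and let $\alpha>1/n$ and $\beta\ge0$ be constants. Let $u(x,t)\in C^2(\overline\Omega\times[0,\infty))$ be a solution of the problem $$u_t=\frac{[\det(u_{ij})]^{\alpha}}{(1+|\nabla u|^2)^{\alpha\beta}}\ \text{ in }\Omega\times(0,\infty),\qquad u(x,t)=0\ \text{ on }\partial\Omega\times(0,\infty),\qquad u(\cdot,t)\ \text{strictly convex for each } t\ge0.$$ If $\beta=0$, then there exists a positive constant $C_1$ depending only on $n$, $\alpha$, $\Omega$ and $u(\cdot,0)$ such that for all $t\ge0$, $$\sup_{\Omega}\left|(1+t)^{\frac{1}{n\alpha-1}}u(x,t)-\psi(x)\right|\le\frac{C_1}{1+t}.$$ If $\beta>0$, then for all $x\in\overline\Omega$ and $t\ge 0$, $$\left[\frac{C_2}{1+t}+G^{\frac{1}{1-n\alpha}}-1\right]\psi(x)\le(1+t)^{\frac{1}{n\alpha-1}}u(x,t)-\psi(x)\le\frac{-C_3\,\psi(x)}{1+t},$$ where $C_2$ and $C_3$ are positive constants depending only on $n$, $\alpha$, $\Omega$ and $u(\cdot,0)$, and $$G=\inf_{\Omega}\left(1+|\nabla u(x,0)|^2\right)^{-\alpha\beta}.$$ Moreover, $$\lim_{t\to\infty}(1+t)^{\frac{1}{n\alpha-1}}u(x,t)=\psi(x)\quad\text{uniformly on }\overline\Omega.$$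
   Context: Notation: $u_t=\partial u/\partial t$, $u_{ij}=\partial^2u/\partial x_i\partial x_j$, $\nabla u=(\partial u/\partial x_1,\dots,\partial u/\partial x_n)$ (spatial gradient). The function $\psi$ is the unique solution in $C^{\infty}(\Omega)\cap C^{0,1}(\overline\Omega)$ of $$\det(\psi_{ij})=\left(\frac{-\psi}{|1-n\alpha|}\right)^{\frac1\alpha}\ \text{ in }\Omega,\qquad\psi=0\ \text{ on }\partial\Omega,\qquad\psi\ \text{strictly convex and }\psi<0\text{ in }\Omega.$$ *)

theory Defs
  imports "HOL-Analysis.Analysis"
begin

text \<open>\<open>C\<^sup>k\<close> on an open set \<open>S\<close>: derivatives are taken along arbitrary constant directions \<open>v\<close>,
  equivalently along the coordinate directions.\<close>

fun Ck_on :: "nat \<Rightarrow> 'a::euclidean_space set \<Rightarrow> ('a \<Rightarrow> real) \<Rightarrow> bool" where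
  "Ck_on 0 S f \<longleftrightarrow> continuous_on S f"
| "Ck_on (Suc k) S f \<longleftrightarrow>
     (\<forall>x\<in>S. f differentiable (at x)) \<and> (\<forall>v. Ck_on k S (\<lambda>x. frechet_derivative f (at x) v))"

definition smooth_on :: "'a::euclidean_space set \<Rightarrow> ('a \<Rightarrow> real) \<Rightarrow> bool" where
  "smooth_on S f \<longleftrightarrow> (\<forall>k. Ck_on k S f)"

text \<open>\<open>f \<in> C\<^sup>k(closure S)\<close> for an open set \<open>S\<close>: \<open>f\<close> is continuous on \<open>closure S\<close>, is \<open>C\<^sup>k\<close> in \<open>S\<close>,
  and every derivative of order at most \<open>k\<close> extends continuously from \<open>S\<close> to \<open>closure S\<close>.\<close>

fun Ck_extends :: "nat \<Rightarrow> 'a::euclidean_space set \<Rightarrow> ('a \<Rightarrow> real) \<Rightarrow> bool" where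
  "Ck_extends 0 S f \<longleftrightarrow> (\<exists>g. continuous_on (closure S) g \<and> (\<forall>x\<in>S. g x = f x))"
| "Ck_extends (Suc k) S f \<longleftrightarrow>
     Ck_extends 0 S f \<and> (\<forall>x\<in>S. f differentiable (at x)) \<and>
     (\<forall>v. Ck_extends k S (\<lambda>x. frechet_derivative f (at x) v))"

definition Ck_on_closure :: "nat \<Rightarrow> 'a::euclidean_space set \<Rightarrow> ('a \<Rightarrow> real) \<Rightarrow> bool" where
  "Ck_on_closure k S f \<longleftrightarrow> continuous_on (closure S) f \<and> Ck_extends k S f"

definition partial_deriv :: "'n \<Rightarrow> (real ^ 'n \<Rightarrow> real) \<Rightarrow> real ^ 'n \<Rightarrow> real" where
  "partial_deriv i f x = frechet_derivative f (at x) (axis i 1)"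

definition grad :: "(real ^ 'n \<Rightarrow> real) \<Rightarrow> real ^ 'n \<Rightarrow> real ^ 'n" where
  "grad f x = (\<chi> i. partial_deriv i f x)"

definition hessian :: "(real ^ 'n \<Rightarrow> real) \<Rightarrow> real ^ 'n \<Rightarrow> real ^ 'n ^ 'n" where
  "hessian f x = (\<chi> i j. partial_deriv j (partial_deriv i f) x)"

definition strictly_convex_fun_on :: "'a::real_vector set \<Rightarrow> ('a \<Rightarrow> real) \<Rightarrow> bool" where
  "strictly_convex_fun_on S f \<longleftrightarrow> convex S \<and>
     (\<forall>x\<in>S. \<forall>y\<in>S. \<forall>s. x \<noteq> y \<and> 0 < s \<and> s < 1 \<longrightarrow>
        f ((1 - s) *\<^sub>R x + s *\<^sub>R y) < (1 - s) * f x + s * f y)"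

definition strictly_convex_set :: "'a::euclidean_space set \<Rightarrow> bool" where
  "strictly_convex_set S \<longleftrightarrow>
     (\<forall>x\<in>closure S. \<forall>y\<in>closure S. x \<noteq> y \<longrightarrow> open_segment x y \<subseteq> interior S)"

text \<open>Smoothness of the boundary by local defining functions: near each boundary point the
  set lies on one side of a smooth regular level hypersurface.\<close>

definition smooth_boundary :: "(real ^ 'n) set \<Rightarrow> bool" where
  "smooth_boundary \<Omega> \<longleftrightarrow>
     (\<forall>p\<in>frontier \<Omega>. \<exists>U \<rho>. open U \<and> p \<in> U \<and> smooth_on U \<rho> \<and>
        (\<forall>x\<in>U. grad \<rho> x \<noteq> 0) \<and> \<Omega> \<inter> U = {x\<in>U. \<rho> x < 0})"

definition smooth_strictly_convex_domain :: "(real ^ 'n) set \<Rightarrow> bool" where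
  "smooth_strictly_convex_domain \<Omega> \<longleftrightarrow>
     open \<Omega> \<and> connected \<Omega> \<and> \<Omega> \<noteq> {} \<and> bounded \<Omega> \<and> strictly_convex_set \<Omega> \<and> smooth_boundary \<Omega>"

text \<open>The boundary value problem satisfied by the profile \<open>\<psi>\<close>; its values outside
  \<open>closure \<Omega>\<close> are irrelevant.\<close>

definition is_profile :: "(real ^ 'n) set \<Rightarrow> real \<Rightarrow> (real ^ 'n \<Rightarrow> real) \<Rightarrow> bool" where
  "is_profile \<Omega> \<alpha> \<psi> \<longleftrightarrow>
     smooth_on \<Omega> \<psi> \<and> (\<exists>L. L-lipschitz_on (closure \<Omega>) \<psi>) \<and>
     (\<forall>x\<in>\<Omega>. det (hessian \<psi> x) = (- \<psi> x / \<bar>1 - real CARD('n) * \<alpha>\<bar>) powr (1 / \<alpha>)) \<and>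
     (\<forall>x\<in>frontier \<Omega>. \<psi> x = 0) \<and>
     strictly_convex_fun_on \<Omega> \<psi> \<and> (\<forall>x\<in>\<Omega>. \<psi> x < 0)"

text \<open>\<open>u \<in> C\<^sup>2(closure \<Omega> \<times> [0,\<infinity>))\<close> is expressed jointly in \<open>(x, t)\<close>, using
  \<open>closure (\<Omega> \<times> (0,\<infinity>)) = closure \<Omega> \<times> [0,\<infinity>)\<close>.\<close>

definition is_flow_solution ::
    "(real ^ 'n) set \<Rightarrow> real \<Rightarrow> real \<Rightarrow> (real ^ 'n \<Rightarrow> real \<Rightarrow> real) \<Rightarrow> bool" where
  "is_flow_solution \<Omega> \<alpha> \<beta> u \<longleftrightarrow>
     Ck_on_closure 2 (\<Omega> \<times> {0<..}) (\<lambda>(x, t). u x t) \<and>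
     (\<forall>x\<in>\<Omega>. \<forall>t>0. deriv (\<lambda>s. u x s) t =
        det (hessian (\<lambda>y. u y t) x) powr \<alpha> /
        (1 + (norm (grad (\<lambda>y. u y t) x))\<^sup>2) powr (\<alpha> * \<beta>)) \<and>
     (\<forall>x\<in>frontier \<Omega>. \<forall>t>0. u x t = 0) \<and>
     (\<forall>t\<ge>0. strictly_convex_fun_on \<Omega> (\<lambda>x. u x t))"

definition G_const :: "(real ^ 'n) set \<Rightarrow> real \<Rightarrow> real \<Rightarrow> (real ^ 'n \<Rightarrow> real) \<Rightarrow> real" where
  "G_const \<Omega> \<alpha> \<beta> v = (INF x\<in>\<Omega>. (1 + (norm (grad v x))\<^sup>2) powr (- (\<alpha> * \<beta>)))"

end

theory Submission
  imports Defs
begin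

text \<open>
  Writing \<open>\<gamma> = 1 / (n\<alpha> - 1)\<close>, the functions \<open>(c + g t)\<^sup>-\<^sup>\<gamma> \<psi>\<close> solve \<open>w\<^sub>t = g det(w\<^sub>i\<^sub>j)\<^sup>\<alpha>\<close>
  exactly and vanish on the boundary. The solution \<open>u\<close> satisfies \<open>u\<^sub>t \<le> det(u\<^sub>i\<^sub>j)\<^sup>\<alpha>\<close> and, as long as
  \<open>(1 + |\<nabla>u|\<^sup>2)\<^sup>-\<^sup>\<alpha>\<^sup>\<beta> \<ge> g\<close>, also \<open>u\<^sub>t \<ge> g det(u\<^sub>i\<^sub>j)\<^sup>\<alpha>\<close>, so such functions bound it from above
  (with \<open>g = 1\<close>) and from below. Initially this holds with suitable \<open>c\<close> because both \<open>u\<close> and \<open>\<psi>\<close> are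
  comparable to the distance to the boundary. Convexity of \<open>u(\<cdot>,t)\<close> and monotonicity in \<open>t\<close> show
  that every slope \<open>|\<nabla>u(x,t)|\<close> is at most some initial slope, which allows \<open>g = G\<close>. The resulting
  lower bound makes the gradient tend to zero, so that restarting at a late time allows \<open>g\<close>
  arbitrarily close to one and gives the limit.
\<close>

section \<open>Positive semidefinite matrices\<close>

text \<open>The power \<open>det^\<alpha>\<close> is homogeneous of degree n\<alpha> in the Hessian,
  and \<gamma> n\<alpha> = \<gamma> + 1 is the identity that lets the time factor of a barrier split
  off. Every comparison is made at a single point: where the difference of solution and barrier has
  a spatial minimum, one Hessian dominates the other as a quadratic form, and monotonicity of the
  determinant passes this on to the time derivatives. Slopes are converted into values, and back, by
  following a ray to its exit point on the boundary, where both u and \<psi> vanish; this takes the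
  place of derivatives at the boundary. The constants must serve every \<beta> and every solution
  with the given initial values, whereas G depends on \<beta> and shrinks as \<beta> grows. Hence c
  is read off from the initial values, and the error of order 1/(1+t) is estimated by a constant in
  c alone, with no negative power of G (\<open>barrier_ratio_le\<close>). When the lower barrier is
  restarted late, the same c is still admissible, because u increases in time.\<close>

definition psd :: "real ^ 'n ^ 'n \<Rightarrow> bool" where
  "psd A \<longleftrightarrow> (\<forall>x. 0 \<le> x \<bullet> (A *v x))"

lemma det_zero_iff_kernel:
  fixes A :: "real ^ 'n ^ 'n"
  shows "det A = 0 \<longleftrightarrow> (\<exists>x. x \<noteq> 0 \<and> A *v x = 0)"
  by (metis invertible_det_nz invertible_left_inverse matrix_left_invertible_ker)

text \<open>If \<open>det A\<close> were negative, the segment from \<open>mat 1\<close> to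
  \<open>A\<close> would contain a singular matrix before its end; but there the quadratic form is
  at least \<open>(1 - s) * (x \<bullet> x)\<close>.\<close>

lemma psd_det_nonneg:
  fixes A :: "real ^ 'n ^ 'n"
  assumes "psd A"
  shows "0 \<le> det A"
proof (rule ccontr)
  assume "\<not> 0 \<le> det A"
  define M where "M s = (1 - s) *\<^sub>R mat 1 + s *\<^sub>R A" for s :: real
  have "continuous_on {0..1} (\<lambda>s. det (M s))"
    unfolding M_def det_def by (intro continuous_intros)
  moreover have "det (M 0) = 1" "det (M 1) = det A"
    by (simp_all add: M_def)
  ultimately obtain s where s: "0 \<le> s" "s \<le> 1" "det (M s) = 0"
    using IVT2'[of "\<lambda>s. det (M s)" 1 0 0] \<open>\<not> 0 \<le> det A\<close> by auto
  have "s \<noteq> 1"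
    using s \<open>\<not> 0 \<le> det A\<close> \<open>det (M 1) = det A\<close> by auto
  obtain x where x: "x \<noteq> 0" "M s *v x = 0"
    using s(3) det_zero_iff_kernel by blast
  have "x \<bullet> (M s *v x) = (1 - s) * (x \<bullet> x) + s * (x \<bullet> (A *v x))"
    by (simp add: M_def matrix_vector_mult_add_rdistrib scaleR_matrix_vector_assoc [symmetric] inner_add_right)
  moreover have "0 < (1 - s) * (x \<bullet> x)"
    using x s \<open>s \<noteq> 1\<close> by simp
  moreover have "0 \<le> s * (x \<bullet> (A *v x))"
    using assms s by (simp add: psd_def)
  ultimately show False
    using x by simp
qed

lemma symmetric_matrix_inner:
  fixes A :: "real ^ 'n ^ 'n"
  assumes "transpose A = A"
  shows "x \<bullet> (A *v y) = y \<bullet> (A *v x)"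
  by (metis assms dot_lmul_matrix inner_commute transpose_matrix_vector)

text \<open>Nonnegativity of the form on the line \<open>x + r *\<^sub>R y\<close> is a quadratic
  inequality in \<open>r\<close>, evaluated at its minimiser when \<open>c\<close> is
  nonzero.\<close>

lemma psd_cauchy_schwarz:
  fixes A :: "real ^ 'n ^ 'n"
  assumes "transpose A = A" "psd A"
  shows "(x \<bullet> (A *v y))\<^sup>2 \<le> (x \<bullet> (A *v x)) * (y \<bullet> (A *v y))"
proof -
  define a b c where "a = x \<bullet> (A *v x)" "b = x \<bullet> (A *v y)" "c = y \<bullet> (A *v y)"
  have q: "0 \<le> a + 2 * r * b + r\<^sup>2 * c" for r
  proof -
    have "0 \<le> (x + r *\<^sub>R y) \<bullet> (A *v (x + r *\<^sub>R y))"
      using assms(2) by (simp add: psd_def)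
    also have "\<dots> = a + 2 * r * b + r\<^sup>2 * c"
      using symmetric_matrix_inner[OF assms(1), of y x]
      by (simp add: a_b_c_def matrix_vector_right_distrib matrix_vector_mult_scaleR inner_add_left
          inner_add_right power2_eq_square algebra_simps)
    finally show ?thesis .
  qed
  have "0 \<le> a" "0 \<le> c"
    using assms(2) by (auto simp: psd_def a_b_c_def)
  show ?thesis
  proof (cases "c = 0")
    case True
    have "b = 0"
    proof (rule ccontr)
      assume "b \<noteq> 0"
      \<comment> \<open>With \<open>c = 0\<close> the quadratic is affine, and this \<open>r\<close>
        gives it the value -1.\<close>
      then show False
        using q[of "- (a + 1) / (2 * b)"] True by (simp add: field_simps)
    qed
    then show ?thesis
      using True by (simp add: a_b_c_def)
  next
    case False
    then have "0 \<le> a * c - b\<^sup>2"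
      using q[of "- b / c"] \<open>0 \<le> c\<close> by (simp add: field_simps power2_eq_square)
    then show ?thesis
      by (simp add: a_b_c_def)
  qed
qed

text \<open>Cauchy-Schwarz with \<open>A *v x\<close> as the other vector shows that a null vector
  of the form is a null vector of the matrix.\<close>

lemma psd_det_nonzero_imp_pos:
  fixes A :: "real ^ 'n ^ 'n"
  assumes "transpose A = A" "psd A" "det A \<noteq> 0" "x \<noteq> 0"
  shows "0 < x \<bullet> (A *v x)"
proof (rule ccontr)
  assume "\<not> 0 < x \<bullet> (A *v x)"
  then have "x \<bullet> (A *v x) = 0"
    using assms(2) by (auto simp: psd_def less_le)
  then have "((A *v x) \<bullet> (A *v x))\<^sup>2 \<le> 0"
    using psd_cauchy_schwarz[OF assms(1,2), of "A *v x" x] by simp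
  then have "A *v x = 0"
    by simp
  then show False
    using assms(3,4) det_zero_iff_kernel by blast
qed

lemma abs_det_le:
  fixes A :: "real ^ 'n ^ 'n"
  assumes "\<And>i j. \<bar>A $ i $ j\<bar> \<le> R"
  shows "\<bar>det A\<bar> \<le> fact CARD('n) * R ^ CARD('n)"
proof -
  have "\<bar>det A\<bar> \<le> (\<Sum>p | p permutes UNIV. \<bar>of_int (sign p) * (\<Prod>i\<in>UNIV. A $ i $ p i)\<bar>)"
    unfolding det_def by (rule sum_abs)
  also have "\<dots> \<le> (\<Sum>p | p permutes (UNIV :: 'n set). R ^ CARD('n))"
  proof (rule sum_mono)
    fix p :: "'n \<Rightarrow> 'n"
    have "(\<Prod>i\<in>UNIV. \<bar>A $ i $ p i\<bar>) \<le> (\<Prod>i\<in>(UNIV :: 'n set). R)"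
      using assms by (intro prod_mono) auto
    then show "\<bar>of_int (sign p) * (\<Prod>i\<in>UNIV. A $ i $ p i)\<bar> \<le> R ^ CARD('n)"
      by (simp add: abs_mult abs_prod sign_def)
  qed
  also have "\<dots> = fact CARD('n) * R ^ CARD('n)"
    by (simp add: card_permutations)
  finally show ?thesis .
qed

text \<open>The powers of \<open>B\<^sup>-\<^sup>1 A\<close> map the ellipsoid \<open>{x. x \<bullet> B x \<le> b}\<close> into itself, hence are
  bounded, and so are the powers of \<open>det (B\<^sup>-\<^sup>1 A)\<close>.\<close>

lemma psd_det_mono:
  fixes A B :: "real ^ 'n ^ 'n"
  assumes symA: "transpose A = A" and symB: "transpose B = B"
    and psdA: "psd A" and psdBA: "psd (B - A)" and det: "det B \<noteq> 0"
  shows "det A \<le> det B"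
proof -
  have le: "x \<bullet> (A *v x) \<le> x \<bullet> (B *v x)" for x
    using psdBA by (simp add: psd_def matrix_vector_mult_diff_rdistrib inner_diff_right)
  then have psdB: "psd B"
    using psdA unfolding psd_def by (meson order_trans)
  obtain Bi where Bi: "B ** Bi = mat 1"
    using det invertible_det_nz invertible_right_inverse by blast
  define M where "M = Bi ** A"
  \<comment> \<open>The trace of \<open>B\<close> as level puts all coordinate vectors into one
    ellipsoid, so that a bound on it bounds every column of the powers.\<close>
  define b where "b = (\<Sum>j\<in>UNIV. axis j 1 \<bullet> (B *v axis j 1))"
  define E where "E = {x. x \<bullet> (B *v x) \<le> b}"
  have BM: "B *v (M *v x) = A *v x" for x
    by (simp add: M_def matrix_vector_mul_assoc matrix_mul_assoc Bi)
  have axisE: "axis j 1 \<in> E" for j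
    unfolding E_def b_def mem_Collect_eq
    by (rule member_le_sum[of j UNIV "\<lambda>j. axis j 1 \<bullet> (B *v axis j 1)"])
      (use psdB in \<open>auto simp: psd_def\<close>)
  have "0 \<le> b"
    unfolding b_def using psdB by (intro sum_nonneg) (auto simp: psd_def)
  obtain K where K: "\<And>x. norm (Bi *v x) \<le> norm x * K"
    using bounded_linear.bounded matrix_vector_mul_bounded_linear by blast
  obtain R where R: "\<And>x. x \<in> E \<Longrightarrow> norm x \<le> R"
  proof
    show "norm x \<le> max 1 (b * K)" if "x \<in> E" for x
    proof (cases "x = 0")
      case False
      have "B *v (Bi *v x) = x"
        by (simp add: matrix_vector_mul_assoc Bi)
      \<comment> \<open>Boundedness of the ellipsoid: writing \<open>x\<close> as
        \<open>B *v (Bi *v x)\<close> lets Cauchy-Schwarz for \<open>B\<close> bound the fourth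
        power of the norm by \<open>b * K\<close> times its square.\<close>
      then have "(x \<bullet> x)\<^sup>2 \<le> (x \<bullet> (B *v x)) * ((Bi *v x) \<bullet> x)"
        using psd_cauchy_schwarz[OF symB psdB, of x "Bi *v x"] by simp
      also have "\<dots> \<le> b * (norm (Bi *v x) * norm x)"
      proof (intro mult_mono norm_cauchy_schwarz)
        show "0 \<le> (Bi *v x) \<bullet> x"
          using psdB \<open>B *v (Bi *v x) = x\<close> unfolding psd_def by metis
      qed (use that \<open>0 \<le> b\<close> in \<open>auto simp: E_def\<close>)
      also have "\<dots> \<le> b * (norm x * K * norm x)"
        using K \<open>0 \<le> b\<close> by (simp add: mult_right_mono mult_left_mono)
      finally have "(norm x)\<^sup>2 * (norm x)\<^sup>2 \<le> (norm x)\<^sup>2 * (b * K)"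
        by (simp add: dot_square_norm power2_eq_square mult_ac)
      then have "(norm x)\<^sup>2 \<le> b * K"
        by (rule mult_left_le_imp_le) (use False in simp)
      then show ?thesis
        by (smt (verit) one_le_power power2_eq_square mult_left_le_imp_le mult_less_cancel_right2 norm_ge_zero)
    qed auto
  qed
  \<comment> \<open>Cauchy-Schwarz for \<open>A\<close>, then domination of \<open>A\<close> by
    \<open>B\<close> in both factors, bounds the square of \<open>q\<close> by \<open>q\<close>
    times the form of \<open>B\<close> at \<open>x\<close>.\<close>
  have ME: "M *v x \<in> E" if "x \<in> E" for x
  proof -
    define q where "q = (M *v x) \<bullet> (B *v (M *v x))"
    have "q\<^sup>2 \<le> (x \<bullet> (A *v x)) * ((M *v x) \<bullet> (A *v (M *v x)))"
      using psd_cauchy_schwarz[OF symA psdA, of "M *v x" x] by (simp add: q_def BM mult.commute)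
    also have "\<dots> \<le> (x \<bullet> (B *v x)) * q"
      unfolding q_def using le psdA psdB by (intro mult_mono) (auto simp: psd_def)
    finally have "q * q \<le> (x \<bullet> (B *v x)) * q"
      by (simp add: power2_eq_square)
    moreover have "0 \<le> q"
      using psdB by (simp add: psd_def q_def)
    ultimately have "q \<le> x \<bullet> (B *v x)"
      using psdB unfolding psd_def by (metis less_eq_real_def mult_right_le_imp_le)
    then show ?thesis
      using that by (simp add: E_def q_def)
  qed
  define P where "P k = ((**) M ^^ k) (mat 1)" for k
  have "P k *v x \<in> E" if "x \<in> E" for k x
    by (induction k) (use that ME in \<open>simp_all add: P_def flip: matrix_vector_mul_assoc\<close>)
  then have "norm (P k *v axis j 1) \<le> R" for k j
    using R axisE by blast
  then have "\<bar>P k $ i $ j\<bar> \<le> R" for k i j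
    by (metis column_def component_le_norm_cart matrix_vector_mult_basis order_trans vec_lambda_beta)
  then have "\<bar>det (P k)\<bar> \<le> fact CARD('n) * R ^ CARD('n)" for k
    by (rule abs_det_le)
  moreover have "det (P k) = det M ^ k" for k
    by (induction k) (simp_all add: P_def det_mul)
  ultimately have "\<bar>det M\<bar> ^ k \<le> fact CARD('n) * R ^ CARD('n)" for k
    by (simp add: power_abs)
  then have "\<bar>det M\<bar> \<le> 1"
    using real_arch_pow[of "\<bar>det M\<bar>"] by (meson not_le)
  have "B ** M = A"
    by (simp add: M_def matrix_mul_assoc Bi)
  then have "det A = det B * det M"
    by (metis det_mul)
  also have "\<dots> \<le> det B * 1"
    using \<open>\<bar>det M\<bar> \<le> 1\<close> psd_det_nonneg[OF psdB] by (intro mult_left_mono) auto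
  finally show ?thesis by simp
qed

section \<open>Second derivatives and Hessians\<close>

lemma has_real_derivative_along_line:
  fixes f :: "'a::real_normed_vector \<Rightarrow> real"
  assumes "(f has_derivative f') (at (x + s *\<^sub>R v))"
  shows "((\<lambda>s. f (x + s *\<^sub>R v)) has_real_derivative f' v) (at s)"
proof -
  have "((\<lambda>s. f (x + s *\<^sub>R v)) has_derivative (\<lambda>h. f' (h *\<^sub>R v))) (at s)"
    by (rule has_derivative_compose[where g = f and g' = f'])
      (use assms in \<open>auto intro!: derivative_eq_intros\<close>)
  moreover have "(\<lambda>h. f' (h *\<^sub>R v)) = (*) (f' v)"
    using has_derivative_linear[OF assms] by (auto simp: linear_cmul mult.commute)
  ultimately show ?thesis
    by (simp add: has_field_derivative_def)
qed

text \<open>The mean value theorem in direction \<open>a\<close>, applied to the difference of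
  \<open>f\<close> on two parallel segments, leaves a difference of values of \<open>f' y a\<close>,
  and differentiability of that function at the single point \<open>x\<close> finishes. Continuity
  of second derivatives is not assumed.\<close>

lemma second_difference_quotient_tendsto:
  fixes f :: "'a::real_normed_vector \<Rightarrow> real"
  assumes S: "open S" "x \<in> S"
    and f: "\<And>y. y \<in> S \<Longrightarrow> (f has_derivative f' y) (at y)"
    and f'': "((\<lambda>y. f' y a) has_derivative A) (at x)"
  shows "((\<lambda>s. (f (x + s *\<^sub>R a + s *\<^sub>R b) - f (x + s *\<^sub>R a) - f (x + s *\<^sub>R b) + f x) / s\<^sup>2)
            \<longlongrightarrow> A b) (at_right 0)"
proof (rule tendstoI)
  fix e :: real assume "e > 0"
  \<comment> \<open>\<open>s * N\<close> exceeds every displacement from \<open>x\<close> that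
    occurs; the two linearisation errors \<open>e' * (s * N)\<close> add up to
    \<open>s * e / 2\<close>.\<close>
  define N where "N = 2 * norm a + norm b + 1"
  define e' where "e' = e / (4 * N)"
  have "N > 0" by (simp add: N_def add_nonneg_pos)
  then have "e' > 0" using \<open>e > 0\<close> by (simp add: e'_def)
  obtain r where r: "r > 0" "ball x r \<subseteq> S"
    using S open_contains_ball by blast
  obtain d where d: "d > 0"
    "\<And>y. norm (y - x) < d \<Longrightarrow> norm (f' y a - f' x a - A (y - x)) \<le> e' * norm (y - x)"
    using f'' \<open>e' > 0\<close> unfolding has_derivative_at_alt by blast
  have linA: "linear A"
    using f'' has_derivative_linear by blast
  have "\<bar>(f (x + s *\<^sub>R a + s *\<^sub>R b) - f (x + s *\<^sub>R a) - f (x + s *\<^sub>R b) + f x) / s\<^sup>2 - A b\<bar> < e"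
    if s: "0 < s" "s < min r d / N" for s
  proof -
    have sN: "s * N < r" "s * N < d"
      using s \<open>N > 0\<close> by (auto simp: field_simps)
    have small: "norm (\<theta> *\<^sub>R a + s *\<^sub>R b) < s * N" "norm (\<theta> *\<^sub>R a) < s * N"
      if "0 \<le> \<theta>" "\<theta> \<le> s" for \<theta>
    proof -
      have "\<theta> * norm a \<le> s * norm a" "0 \<le> s * norm b" "0 \<le> s * norm a"
        using that by (auto intro: mult_right_mono)
      moreover have sN: "s * N = 2 * (s * norm a) + s * norm b + s"
        by (simp add: N_def algebra_simps)
      ultimately have "\<theta> * norm a < s * N"
        using s(1) by linarith
      then show "norm (\<theta> *\<^sub>R a) < s * N"
        using that(1) by simp
      have "norm (\<theta> *\<^sub>R a + s *\<^sub>R b) \<le> \<theta> * norm a + s * norm b"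
        using that norm_triangle_ineq[of "\<theta> *\<^sub>R a" "s *\<^sub>R b"] by simp
      then show "norm (\<theta> *\<^sub>R a + s *\<^sub>R b) < s * N"
        using \<open>\<theta> * norm a \<le> s * norm a\<close> \<open>0 \<le> s * norm a\<close> s(1) sN by linarith
    qed
    have inS: "(x + s *\<^sub>R b) + \<theta> *\<^sub>R a \<in> S" "x + \<theta> *\<^sub>R a \<in> S" if "0 \<le> \<theta>" "\<theta> \<le> s" for \<theta>
      using small[OF that] sN r(2) by (auto simp: subset_iff dist_norm add_ac norm_minus_commute)
    define g where "g \<theta> = f ((x + s *\<^sub>R b) + \<theta> *\<^sub>R a) - f (x + \<theta> *\<^sub>R a)" for \<theta>
    define g' where "g' \<theta> = f' ((x + s *\<^sub>R b) + \<theta> *\<^sub>R a) a - f' (x + \<theta> *\<^sub>R a) a" for \<theta>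
    have "(g has_real_derivative g' \<theta>) (at \<theta>)" if "0 \<le> \<theta>" "\<theta> \<le> s" for \<theta>
      unfolding g_def g'_def using inS[OF that]
      by (intro DERIV_diff has_real_derivative_along_line f)
    then obtain \<theta> where \<theta>: "0 < \<theta>" "\<theta> < s" "g s - g 0 = s * g' \<theta>"
      using MVT2[of 0 s g g'] s by auto
    have "norm (f' ((x + s *\<^sub>R b) + \<theta> *\<^sub>R a) a - f' x a - A (\<theta> *\<^sub>R a + s *\<^sub>R b)) \<le> e' * (s * N)"
      using d(2)[of "(x + s *\<^sub>R b) + \<theta> *\<^sub>R a"] small(1)[of \<theta>] \<theta> sN \<open>e' > 0\<close>
      by (smt (verit, ccfv_SIG) add.commute add.left_commute add_diff_cancel_left' mult_left_mono)
    moreover have "norm (f' (x + \<theta> *\<^sub>R a) a - f' x a - A (\<theta> *\<^sub>R a)) \<le> e' * (s * N)"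
      using d(2)[of "x + \<theta> *\<^sub>R a"] small(2)[of \<theta>] \<theta> sN \<open>e' > 0\<close>
      by (smt (verit, ccfv_SIG) add_diff_cancel_left' mult_left_mono)
    moreover have "A (\<theta> *\<^sub>R a + s *\<^sub>R b) = A (\<theta> *\<^sub>R a) + s * A b"
      using linA by (simp add: linear_add linear_cmul)
    ultimately have "\<bar>g' \<theta> - s * A b\<bar> \<le> 2 * e' * (s * N)"
      by (auto simp: g'_def abs_le_iff)
    also have "\<dots> < s * e"
      using \<open>N > 0\<close> s(1) \<open>e > 0\<close> by (simp add: e'_def)
    finally have g': "\<bar>g' \<theta> - s * A b\<bar> < s * e" .
    have "(f (x + s *\<^sub>R a + s *\<^sub>R b) - f (x + s *\<^sub>R a) - f (x + s *\<^sub>R b) + f x) / s\<^sup>2 - A b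
        = (g' \<theta> - s * A b) / s"
      using \<theta>(3) s(1) by (simp add: g_def power2_eq_square field_simps add_ac)
    then show ?thesis
      using g' s(1) by (simp add: pos_divide_less_eq mult.commute)
  qed
  moreover have "min r d / N > 0"
    using r d \<open>N > 0\<close> by simp
  ultimately show "\<forall>\<^sub>F s in at_right 0. dist ((f (x + s *\<^sub>R a + s *\<^sub>R b) - f (x + s *\<^sub>R a) -
      f (x + s *\<^sub>R b) + f x) / s\<^sup>2) (A b) < e"
    unfolding eventually_at_right_field dist_real_def by blast
qed

text \<open>The second difference quotient is symmetric in \<open>a\<close> and \<open>b\<close>, so
  its two limits agree.\<close>

lemma second_derivative_symmetric:
  fixes f :: "'a::real_normed_vector \<Rightarrow> real"
  assumes S: "open S" "x \<in> S"
    and f: "\<And>y. y \<in> S \<Longrightarrow> (f has_derivative f' y) (at y)"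
    and A: "((\<lambda>y. f' y a) has_derivative A) (at x)"
    and B: "((\<lambda>y. f' y b) has_derivative B) (at x)"
  shows "A b = B a"
proof -
  have "((\<lambda>s. (f (x + s *\<^sub>R a + s *\<^sub>R b) - f (x + s *\<^sub>R a) - f (x + s *\<^sub>R b) + f x) / s\<^sup>2)
            \<longlongrightarrow> B a) (at_right 0)"
    using second_difference_quotient_tendsto[OF S f B, of a] by (simp add: algebra_simps)
  then show ?thesis
    using second_difference_quotient_tendsto[OF S f A, of b] tendsto_unique trivial_limit_at_right_real
    by blast
qed

text \<open>A negative \<open>k\<close> makes \<open>g'\<close> drop below \<open>g' 0\<close> to
  the right of 0, and the mean value theorem then puts \<open>g\<close> strictly below its
  tangent.\<close>

lemma second_derivative_nonneg_of_tangent: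
  fixes g :: "real \<Rightarrow> real"
  assumes "e > 0"
    and g: "\<And>s. \<bar>s\<bar> < e \<Longrightarrow> (g has_real_derivative g' s) (at s)"
    and g'': "(g' has_real_derivative k) (at 0)"
    and tangent: "\<And>s. \<bar>s\<bar> < e \<Longrightarrow> g s \<ge> g 0 + s * g' 0"
  shows "0 \<le> k"
proof (rule ccontr)
  assume "\<not> 0 \<le> k"
  then obtain d where d: "d > 0" "\<And>h. 0 < h \<Longrightarrow> h < d \<Longrightarrow> g' h < g' 0"
    using DERIV_neg_dec_right[OF g''] by auto
  define s where "s = min d e / 2"
  have s: "0 < s" "s < d" "s < e"
    using d \<open>e > 0\<close> by (auto simp: s_def)
  obtain \<theta> where "0 < \<theta>" "\<theta> < s" "g s - g 0 = s * g' \<theta>"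
    using MVT2[of 0 s g g'] g s by auto
  then have "g s - g 0 < s * g' 0"
    using d(2)[of \<theta>] s by simp
  then show False
    using tangent[of s] s by simp
qed

text \<open>The regularity shared by \<psi> and by \<open>u\<close> at a fixed positive time;
  continuity of second derivatives is not part of it.\<close>

definition twice_differentiable_on :: "(real ^ 'n) set \<Rightarrow> (real ^ 'n \<Rightarrow> real) \<Rightarrow> bool" where
  "twice_differentiable_on S f \<longleftrightarrow>
     (\<forall>x\<in>S. f differentiable (at x)) \<and>
     (\<forall>v. \<forall>x\<in>S. (\<lambda>y. frechet_derivative f (at y) v) differentiable (at x))"

lemma frechet_derivative_eq_grad:
  fixes f :: "real ^ 'n \<Rightarrow> real"
  assumes "f differentiable (at x)"
  shows "frechet_derivative f (at x) v = grad f x \<bullet> v"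
proof -
  have lin: "linear (frechet_derivative f (at x))"
    using assms by (rule linear_frechet_derivative)
  have "frechet_derivative f (at x) v = frechet_derivative f (at x) (\<Sum>i\<in>UNIV. v $ i *\<^sub>R axis i 1)"
    using basis_expansion[of v] by (simp add: scalar_mult_eq_scaleR)
  also have "\<dots> = grad f x \<bullet> v"
    using lin by (simp add: linear_sum linear_cmul inner_vec_def grad_def partial_deriv_def mult.commute)
  finally show ?thesis .
qed

lemma has_derivative_grad:
  fixes f :: "real ^ 'n \<Rightarrow> real"
  assumes "f differentiable (at x)"
  shows "(f has_derivative (\<lambda>v. grad f x \<bullet> v)) (at x)"
  using assms frechet_derivative_eq_grad[OF assms, symmetric] by (simp add: frechet_derivative_works)

lemma has_derivative_imp_grad_inner:
  fixes f :: "real ^ 'n \<Rightarrow> real"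
  assumes "(f has_derivative f') (at x)"
  shows "f' v = grad f x \<bullet> v"
  using assms by (metis differentiableI frechet_derivative_at frechet_derivative_eq_grad)

lemma twice_differentiable_onD:
  assumes "twice_differentiable_on S f" "open S" "x \<in> S"
  shows "f differentiable (at x)"
    and "((\<lambda>y. grad f y \<bullet> v) has_derivative (\<lambda>w. v \<bullet> (hessian f x *v w))) (at x)"
proof -
  have d: "f differentiable (at y)" if "y \<in> S" for y
    using assms that by (auto simp: twice_differentiable_on_def)
  then show "f differentiable (at x)"
    using assms by auto
  have "partial_deriv i f differentiable (at x)" for i
    using assms unfolding partial_deriv_def [abs_def] twice_differentiable_on_def by blast
  then have "((\<lambda>y. \<Sum>i\<in>UNIV. partial_deriv i f y * v $ i) has_derivative
      (\<lambda>w. \<Sum>i\<in>UNIV. (grad (partial_deriv i f) x \<bullet> w) * v $ i)) (at x)"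
    by (intro has_derivative_sum has_derivative_mult_left has_derivative_grad)
  moreover have "(\<Sum>i\<in>UNIV. (grad (partial_deriv i f) x \<bullet> w) * v $ i) = v \<bullet> (hessian f x *v w)" for w
    by (simp add: inner_vec_def grad_def hessian_def matrix_vector_mult_def mult.commute)
  ultimately show "((\<lambda>y. grad f y \<bullet> v) has_derivative (\<lambda>w. v \<bullet> (hessian f x *v w))) (at x)"
    by (simp add: inner_vec_def grad_def)
qed

lemma hessian_eqI:
  fixes f :: "real ^ 'n \<Rightarrow> real"
  assumes S: "open S" "x \<in> S"
    and f: "\<And>y. y \<in> S \<Longrightarrow> (f has_derivative (\<lambda>v. p y \<bullet> v)) (at y)"
    and p: "\<And>v. ((\<lambda>y. p y \<bullet> v) has_derivative (\<lambda>w. v \<bullet> (H *v w))) (at x)"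
  shows "hessian f x = H"
proof -
  have "partial_deriv i f y = p y \<bullet> axis i 1" if "y \<in> S" for i y
    using frechet_derivative_at[OF f[OF that]] by (metis partial_deriv_def)
  then have "(partial_deriv i f has_derivative (\<lambda>w. axis i 1 \<bullet> (H *v w))) (at x)" for i
    by (intro has_derivative_transform_within_open[OF p S]) auto
  then have "partial_deriv j (partial_deriv i f) x = axis i 1 \<bullet> (H *v axis j 1)" for i j
    by (metis frechet_derivative_at partial_deriv_def)
  then show ?thesis
    by (simp add: hessian_def vec_eq_iff inner_axis' matrix_vector_mult_basis column_def)
qed

lemma hessian_symmetric:
  assumes "twice_differentiable_on S f" "open S" "x \<in> S"
  shows "transpose (hessian f x) = hessian f x"
proof -
  have "axis i 1 \<bullet> (hessian f x *v axis j 1) = axis j 1 \<bullet> (hessian f x *v axis i 1)" for i j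
    by (rule second_derivative_symmetric[OF assms(2,3), of f "\<lambda>y v. grad f y \<bullet> v"])
      (use assms twice_differentiable_onD in \<open>blast intro: has_derivative_grad\<close>)+
  then show ?thesis
    by (simp add: transpose_def vec_eq_iff inner_axis' matrix_vector_mult_basis column_def)
qed

lemma hessian_psd_of_tangent:
  fixes f :: "real ^ 'n \<Rightarrow> real"
  assumes f: "twice_differentiable_on S f" and S: "open S" "x \<in> S"
    and tangent: "\<And>y. y \<in> S \<Longrightarrow> f y \<ge> f x + grad f x \<bullet> (y - x)"
  shows "psd (hessian f x)"
  unfolding psd_def
proof
  fix v :: "real ^ 'n"
  obtain r where r: "r > 0" "ball x r \<subseteq> S"
    using S open_contains_ball by blast
  define e where "e = r / (norm v + 1)"
  have "e > 0"
    using r by (simp add: e_def add_nonneg_pos)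
  have inS: "x + s *\<^sub>R v \<in> S" if "\<bar>s\<bar> < e" for s
  proof -
    have "\<bar>s\<bar> * (norm v + 1) < r"
      using that by (simp add: e_def add_nonneg_pos flip: pos_less_divide_eq)
    then have "norm (s *\<^sub>R v) < r"
      by (simp add: algebra_simps)
    then show ?thesis
      using r by (auto simp: dist_norm subset_iff)
  qed
  show "0 \<le> v \<bullet> (hessian f x *v v)"
  proof (rule second_derivative_nonneg_of_tangent[OF \<open>e > 0\<close>,
        of "\<lambda>s. f (x + s *\<^sub>R v)" "\<lambda>s. grad f (x + s *\<^sub>R v) \<bullet> v"])
    show "((\<lambda>s. f (x + s *\<^sub>R v)) has_real_derivative grad f (x + s *\<^sub>R v) \<bullet> v) (at s)"
      if "\<bar>s\<bar> < e" for s
      by (intro has_real_derivative_along_line has_derivative_grad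
          twice_differentiable_onD(1)[OF f S(1)] inS that)
    show "((\<lambda>s. grad f (x + s *\<^sub>R v) \<bullet> v) has_real_derivative v \<bullet> (hessian f x *v v)) (at 0)"
      by (rule has_real_derivative_along_line) (simp add: twice_differentiable_onD(2)[OF f S])
    show "f (x + 0 *\<^sub>R v) + s * (grad f (x + 0 *\<^sub>R v) \<bullet> v) \<le> f (x + s *\<^sub>R v)" if "\<bar>s\<bar> < e" for s
      using tangent[OF inS[OF that]] by simp
  qed
qed

section \<open>Convex functions vanishing on the boundary\<close>

lemma strictly_convex_fun_on_imp_convex_on:
  assumes "strictly_convex_fun_on S f"
  shows "convex_on S f"
proof (rule convex_onI)
  fix t :: real and x y assume "0 < t" "t < 1" "x \<in> S" "y \<in> S"
  then show "f ((1 - t) *\<^sub>R x + t *\<^sub>R y) \<le> (1 - t) * f x + t * f y"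
  proof (cases "x = y")
    case True
    have "(1 - t) *\<^sub>R y + t *\<^sub>R y = y" "(1 - t) * f y + t * f y = f y"
      by (simp_all add: scaleR_diff_left left_diff_distrib)
    then show ?thesis
      using True by simp
  next
    case False
    then show ?thesis
      using assms \<open>0 < t\<close> \<open>t < 1\<close> \<open>x \<in> S\<close> \<open>y \<in> S\<close>
      unfolding strictly_convex_fun_on_def by (simp add: less_imp_le)
  qed
qed (use assms in \<open>simp add: strictly_convex_fun_on_def\<close>)

text \<open>\<open>x\<close> is the convex combination of \<open>z\<close> and the exit point with
  weights \<open>d / (1 + d)\<close> and \<open>1 / (1 + d)\<close>, and \<open>f\<close> vanishes
  at the exit point. Convexity holds inside \<open>S\<close> only, so the inequality is obtained
  before the exit and passed to the limit.\<close>

lemma convex_on_zero_frontier_ray: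
  fixes f :: "'a::euclidean_space \<Rightarrow> real"
  assumes "open S" "bounded S" "continuous_on (closure S) f" "convex_on S f"
    and fr: "\<And>y. y \<in> frontier S \<Longrightarrow> f y = 0"
    and "z \<in> S" "x \<in> S" "x \<noteq> z"
  obtains d where "d > 0" "x + d *\<^sub>R (x - z) \<in> frontier S" "(1 + d) * f x \<le> d * f z"
proof -
  obtain d where d: "d > 0" "x + d *\<^sub>R (x - z) \<in> frontier S"
    "\<And>e. 0 \<le> e \<Longrightarrow> e < d \<Longrightarrow> x + e *\<^sub>R (x - z) \<in> interior S"
    using ray_to_frontier[of S x "x - z"] assms by (auto simp: interior_open)
  have cl: "closure {0..<d} = {0..d}"
    using d by simp
  have "x + e *\<^sub>R (x - z) \<in> closure S" if "e \<in> {0..d}" for e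
  proof (cases "e = d")
    case True
    then show ?thesis using d(2) by (simp add: frontier_def)
  next
    case False
    then show ?thesis using d(3)[of e] that \<open>open S\<close> closure_subset by (auto simp: interior_open)
  qed
  then have "continuous_on {0..d} (\<lambda>e. f (x + e *\<^sub>R (x - z)) + e * f z - (1 + e) * f x)"
    by (intro continuous_intros continuous_on_compose2[OF assms(3)]) auto
  then have "f (x + d *\<^sub>R (x - z)) + d * f z - (1 + d) * f x \<ge> 0"
  proof (rule continuous_ge_on_closure[of "{0..<d}", unfolded cl])
    show "0 \<le> f (x + e *\<^sub>R (x - z)) + e * f z - (1 + e) * f x" if "e \<in> {0..<d}" for e
    proof -
      have inS: "x + e *\<^sub>R (x - z) \<in> S"
        using d(3)[of e] that \<open>open S\<close> by (simp add: interior_open)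
      have "1 + e > 0" using that by simp
      have "f ((1 - e / (1 + e)) *\<^sub>R (x + e *\<^sub>R (x - z)) + (e / (1 + e)) *\<^sub>R z)
          \<le> (1 - e / (1 + e)) * f (x + e *\<^sub>R (x - z)) + (e / (1 + e)) * f z"
        using that by (intro convex_onD[OF assms(4)] inS \<open>z \<in> S\<close>) auto
      also have "(1 - e / (1 + e)) *\<^sub>R (x + e *\<^sub>R (x - z)) + (e / (1 + e)) *\<^sub>R z = x"
      proof -
        define c where "c = inverse (1 + e)"
        have "1 - e / (1 + e) = c" "e / (1 + e) = c * e"
          using \<open>1 + e > 0\<close> by (simp_all add: c_def field_simps)
        then have "(1 - e / (1 + e)) *\<^sub>R (x + e *\<^sub>R (x - z)) + (e / (1 + e)) *\<^sub>R z
            = c *\<^sub>R (x + e *\<^sub>R (x - z)) + (c * e) *\<^sub>R z"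
          by (simp only:)
        also have "\<dots> = inverse (1 + e) *\<^sub>R ((1 + e) *\<^sub>R x)"
          unfolding c_def [symmetric] by (simp add: algebra_simps)
        finally have "(1 - e / (1 + e)) *\<^sub>R (x + e *\<^sub>R (x - z)) + (e / (1 + e)) *\<^sub>R z
            = inverse (1 + e) *\<^sub>R ((1 + e) *\<^sub>R x)" .
        then show ?thesis
          using \<open>1 + e > 0\<close> by simp
      qed
      finally have "f x \<le> (1 - e / (1 + e)) * f (x + e *\<^sub>R (x - z)) + (e / (1 + e)) * f z" .
      then have "(1 + e) * f x \<le> (1 + e) * ((1 - e / (1 + e)) * f (x + e *\<^sub>R (x - z)) + (e / (1 + e)) * f z)"
        using \<open>1 + e > 0\<close> by (intro mult_left_mono) auto
      also have "\<dots> = f (x + e *\<^sub>R (x - z)) + e * f z"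
      proof -
        have "(1 + e) * (1 - e / (1 + e)) = 1" "(1 + e) * (e / (1 + e)) = e"
          using \<open>1 + e > 0\<close> by (simp_all add: field_simps)
        then show ?thesis
          by (simp only: distrib_left mult.assoc [symmetric] mult_1)
      qed
      finally show ?thesis by simp
    qed
  qed (use d in auto)
  then have "(1 + d) * f x \<le> d * f z"
    using fr[OF d(2)] by simp
  then show thesis
    using d that by blast
qed

lemma open_symmetric_pair:
  fixes S :: "'a::euclidean_space set"
  assumes "open S" "x \<in> S"
  obtains w where "w \<noteq> 0" "x + w \<in> S" "x - w \<in> S"
proof -
  obtain r where r: "r > 0" "cball x r \<subseteq> S"
    using assms open_contains_cball by blast
  obtain w :: 'a where "norm w = r"
    using vector_choose_size[of r] r by auto
  then show thesis
    using r that[of w] by (auto simp: subset_iff dist_norm)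
qed

text \<open>At an interior maximum the ray inequality with a nearby base point forces a nonpositive
  value, so \<open>f\<close> is nonpositive throughout; strictness enters by viewing
  \<open>x\<close> as the midpoint of two points of \<open>S\<close>.\<close>

lemma strictly_convex_zero_frontier_neg:
  fixes f :: "'a::euclidean_space \<Rightarrow> real"
  assumes "open S" "bounded S" "continuous_on (closure S) f" "strictly_convex_fun_on S f"
    and fr: "\<And>y. y \<in> frontier S \<Longrightarrow> f y = 0"
    and "x \<in> S"
  shows "f x < 0"
proof -
  note cvx = strictly_convex_fun_on_imp_convex_on[OF assms(4)]
  have sc: "f ((1 - s) *\<^sub>R a + s *\<^sub>R b) < (1 - s) * f a + s * f b"
    if "a \<in> S" "b \<in> S" "a \<noteq> b" "0 < s" "s < 1" for a b s
    using assms(4) that by (simp add: strictly_convex_fun_on_def)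
  have "compact (closure S)" "closure S \<noteq> {}"
    using assms by (auto simp: closure_subset compact_closure)
  then obtain m where m: "m \<in> closure S" "\<And>y. y \<in> closure S \<Longrightarrow> f y \<le> f m"
    using continuous_attains_sup[OF _ _ assms(3)] by blast
  have "f m \<le> 0"
  proof (cases "m \<in> S")
    case True
    then obtain w where w: "w \<noteq> 0" "m + w \<in> S"
      using open_symmetric_pair assms(1) by blast
    obtain d where "d > 0" "(1 + d) * f m \<le> d * f (m + w)"
      using convex_on_zero_frontier_ray[OF assms(1-3) cvx fr w(2) True] w by auto
    moreover have "d * f (m + w) \<le> d * f m"
      using m(2)[of "m + w"] w \<open>d > 0\<close> closure_subset by (intro mult_left_mono) auto
    moreover have "(1 + d) * f m = f m + d * f m"
      by (simp add: algebra_simps)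
    ultimately show ?thesis
      by linarith
  next
    case False
    then show ?thesis
      using m fr[of m] assms(1) by (auto simp: frontier_def interior_open)
  qed
  then have le0: "f y \<le> 0" if "y \<in> S" for y
    using m(2)[of y] that closure_subset by force
  obtain w where w: "w \<noteq> 0" "x + w \<in> S" "x - w \<in> S"
    using open_symmetric_pair assms(1) \<open>x \<in> S\<close> by blast
  have "x + w \<noteq> x - w"
  proof
    assume "x + w = x - w"
    then have "2 *\<^sub>R w = 0" by (simp add: scaleR_2 algebra_simps)
    then show False using w by simp
  qed
  then have "f ((1 - 1/2) *\<^sub>R (x + w) + (1/2) *\<^sub>R (x - w)) < (1 - 1/2) * f (x + w) + (1/2) * f (x - w)"
    by (intro sc w \<open>x + w \<noteq> x - w\<close>) auto
  moreover have "(1 - 1/2) *\<^sub>R (x + w) + (1/2) *\<^sub>R (x - w) = (1/2) *\<^sub>R ((x + w) + (x - w))"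
    unfolding scaleR_add_right by simp
  moreover have "(1/2) *\<^sub>R ((x + w) + (x - w)) = x"
    using scaleR_half_double[of x] by simp
  ultimately show ?thesis
    using le0[OF w(2)] le0[OF w(3)] by simp
qed

text \<open>A convex function vanishing on the boundary decays at least linearly in the distance to the
  boundary, hence dominates every function of linear decay.\<close>

lemma linear_decay_bounded_by_convex:
  fixes f g :: "'a::euclidean_space \<Rightarrow> real"
  assumes S: "open S" "bounded S" "z \<in> S" and g: "continuous_on (closure S) g" "convex_on S g"
    and fr: "\<And>y. y \<in> frontier S \<Longrightarrow> g y = 0" "\<And>y. y \<in> frontier S \<Longrightarrow> f y = 0"
    and "g z < 0" "L \<ge> 0"
    and L: "\<And>x y. x \<in> S \<Longrightarrow> y \<in> frontier S \<Longrightarrow> - f x \<le> L * norm (y - x)"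
  obtains K where "K > 0" "\<And>x. x \<in> closure S \<Longrightarrow> K * g x \<le> f x"
proof -
  obtain D where D: "D > 0" "\<And>y. y \<in> closure S \<Longrightarrow> norm (y - z) \<le> D"
  proof -
    obtain D where "\<forall>y\<in>closure S. dist z y \<le> D"
      using bounded_any_center[of "closure S" z] S bounded_closure by blast
    then show thesis
      using that[of "max 1 D"] by (force simp: dist_norm norm_minus_commute)
  qed
  define m where "m = - g z"
  \<comment> \<open>\<open>L * D\<close> serves points other than \<open>z\<close>, the absolute
    value serves \<open>z\<close> itself, and the 1 makes \<open>K\<close> positive.\<close>
  define K where "K = (L * D + \<bar>f z\<bar>) / m + 1"
  have "m > 0" using \<open>g z < 0\<close> by (simp add: m_def)
  have "K > 0" using \<open>m > 0\<close> \<open>L \<ge> 0\<close> D by (simp add: K_def add_nonneg_pos)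
  have Km: "K * m \<ge> L * D" "K * m \<ge> \<bar>f z\<bar>"
    using \<open>m > 0\<close> \<open>L \<ge> 0\<close> D by (auto simp: K_def field_simps)
  have "K * g x \<le> f x" if "x \<in> closure S" for x
  proof -
    have "x \<in> S \<or> x \<in> frontier S"
      using that S by (auto simp: frontier_def interior_open)
    then consider "x \<in> frontier S" | "x = z" | "x \<in> S" "x \<noteq> z"
      by blast
    then show ?thesis
    proof cases
      case 1
      then show ?thesis using fr by simp
    next
      case 2
      then show ?thesis using Km(2) by (simp add: m_def)
    next
      case 3
      obtain d where d: "d > 0" "x + d *\<^sub>R (x - z) \<in> frontier S" "(1 + d) * g x \<le> d * g z"
        using convex_on_zero_frontier_ray[OF S(1,2) g fr(1) S(3) 3] by blast
      \<comment> \<open>The common factor of both estimates: the distance from \<open>x\<close> to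
        the exit point is at most \<open>q * D\<close>, and \<open>- g x\<close> is at least
        \<open>q * m\<close>.\<close>
      define q where "q = d / (1 + d)"
      have "q > 0" using d by (simp add: q_def)
      have "x + d *\<^sub>R (x - z) - z = (1 + d) *\<^sub>R (x - z)"
        by (simp add: algebra_simps)
      then have "(1 + d) * norm (x - z) \<le> D"
        using D(2)[of "x + d *\<^sub>R (x - z)"] d by (simp add: frontier_def)
      then have "q * ((1 + d) * norm (x - z)) \<le> q * D"
        using \<open>q > 0\<close> by (intro mult_left_mono) auto
      moreover have "q * (1 + d) = d"
        using d by (simp add: q_def)
      ultimately have "d * norm (x - z) \<le> q * D"
        by (simp flip: mult.assoc)
      then have "- f x \<le> L * (q * D)"
        using L[OF 3(1) d(2)] d \<open>L \<ge> 0\<close> by (simp add: mult_left_mono order_trans)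
      also have "\<dots> \<le> q * (K * m)"
        using Km(1) \<open>q > 0\<close> by (simp add: mult.left_commute mult_left_mono)
      also have "\<dots> = K * (q * m)"
        by simp
      also have "\<dots> \<le> K * (- g x)"
      proof (rule mult_left_mono)
        show "q * m \<le> - g x"
          using d(1,3) by (simp add: q_def m_def pos_le_divide_eq mult.commute)
      qed (use \<open>K > 0\<close> in simp)
      finally show ?thesis by simp
    qed
  qed
  then show thesis
    using \<open>K > 0\<close> that by blast
qed

text \<open>Adding \<open>\<delta> (t - T)\<close> makes the time derivative positive at a negative interior minimum.\<close>

lemma parabolic_minimum_principle:
  fixes h :: "'a::euclidean_space \<Rightarrow> real \<Rightarrow> real"
  assumes S: "open S" "bounded S"
    and cont: "continuous_on (closure S \<times> {T..}) (\<lambda>(x, t). h x t)"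
    and init: "\<And>x. x \<in> closure S \<Longrightarrow> 0 \<le> h x T"
    and fr: "\<And>x t. x \<in> frontier S \<Longrightarrow> T \<le> t \<Longrightarrow> 0 \<le> h x t"
    and min: "\<And>x t. x \<in> S \<Longrightarrow> T < t \<Longrightarrow> (\<And>y. y \<in> S \<Longrightarrow> h x t \<le> h y t) \<Longrightarrow>
       \<exists>D\<ge>0. ((\<lambda>s. h x s) has_real_derivative D) (at t)"
    and x1: "x1 \<in> closure S" "T \<le> t1"
  shows "0 \<le> h x1 t1"
proof (rule ccontr)
  assume neg: "\<not> 0 \<le> h x1 t1"
  define N where "N = t1 - T + 1"
  have "N > 0" using x1 by (simp add: N_def)
  \<comment> \<open>Chosen so that up to time \<open>t1\<close> the perturbation uses at most half
    of the negativity at \<open>(x1, t1)\<close>.\<close>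
  define \<delta> where "\<delta> = - h x1 t1 / (2 * N)"
  have "\<delta> > 0" "h x1 t1 + \<delta> * (t1 - T) < 0"
  proof -
    show "\<delta> > 0" unfolding \<delta>_def using neg \<open>N > 0\<close> by (intro divide_pos_pos) auto
    have "\<delta> * (t1 - T) \<le> \<delta> * N" using \<open>\<delta> > 0\<close> by (simp add: N_def)
    also have "\<dots> = - h x1 t1 / 2" using \<open>N > 0\<close> by (simp add: \<delta>_def)
    finally show "h x1 t1 + \<delta> * (t1 - T) < 0" using neg by simp
  qed
  define k where "k = (\<lambda>(x, t). h x t + \<delta> * (t - T))"
  define Q where "Q = closure S \<times> {T..t1}"
  have "continuous_on Q k"
    unfolding k_def Q_def case_prod_beta
    by (intro continuous_intros continuous_on_subset[OF cont[unfolded case_prod_beta]]) auto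
  moreover have "compact Q" "Q \<noteq> {}"
    using S x1 by (auto simp: Q_def compact_Times compact_closure)
  ultimately obtain q where q: "q \<in> Q" "\<And>p. p \<in> Q \<Longrightarrow> k q \<le> k p"
    using continuous_attains_inf[of Q k] by blast
  obtain x0 t0 where q0: "q = (x0, t0)" by (cases q)
  have x0: "x0 \<in> closure S" "T \<le> t0" "t0 \<le> t1"
    using q q0 by (auto simp: Q_def)
  have kmin: "h x0 t0 + \<delta> * (t0 - T) \<le> h x t + \<delta> * (t - T)" if "x \<in> closure S" "T \<le> t" "t \<le> t1" for x t
    using q(2)[of "(x, t)"] that by (simp add: k_def Q_def q0)
  have neg0: "h x0 t0 + \<delta> * (t0 - T) < 0"
    using kmin[OF x1(1), of t1] x1 \<open>h x1 t1 + \<delta> * (t1 - T) < 0\<close> by simp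
  then have "h x0 t0 < 0"
    using \<open>\<delta> > 0\<close> x0(2) by (smt (verit) mult_nonneg_nonneg)
  then have "x0 \<in> S" "T < t0"
    using init[of x0] fr[of x0 t0] x0 S by (force simp: frontier_def interior_open less_le)+
  have "h x0 t0 \<le> h y t0" if "y \<in> S" for y
    using kmin[of y t0] that x0 closure_subset by force
  then obtain D where D: "D \<ge> 0" "((\<lambda>s. h x0 s) has_real_derivative D) (at t0)"
    using min[OF \<open>x0 \<in> S\<close> \<open>T < t0\<close>] by blast
  have "((\<lambda>s. h x0 s + \<delta> * (s - T)) has_real_derivative D + \<delta>) (at t0)"
    using D(2) by (auto intro!: derivative_eq_intros)
  then obtain d where d: "d > 0" "\<And>e. 0 < e \<Longrightarrow> e < d \<Longrightarrow>
      h x0 (t0 - e) + \<delta> * (t0 - e - T) < h x0 t0 + \<delta> * (t0 - T)"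
    using DERIV_pos_inc_left[of "\<lambda>s. h x0 s + \<delta> * (s - T)" "D + \<delta>" t0] D(1) \<open>\<delta> > 0\<close> by auto
  \<comment> \<open>The earlier time \<open>t0 - e\<close> has to stay in \<open>{T..t1}\<close> to
    contradict the minimality of \<open>(x0, t0)\<close>.\<close>
  define e where "e = min d (t0 - T) / 2"
  have "0 < e" "e < d" "e \<le> t0 - T"
    using d(1) \<open>T < t0\<close> by (auto simp: e_def)
  then show False
    using d(2)[of e] kmin[OF x0(1), of "t0 - e"] x0 by simp
qed

section \<open>Rates for powers of quotients of shifted times\<close>

lemma one_minus_powr_quotient_le:
  fixes c t \<gamma> :: real
  assumes "1 \<le> c" "0 \<le> t" "0 < \<gamma>"
  shows "1 - ((1 + t) / (c + t)) powr \<gamma> \<le> \<gamma> * (c - 1) / (1 + t)"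
proof -
  \<comment> \<open>The bound \<open>ln x \<le> x - 1\<close> controls the exponent, and
    \<open>exp y \<ge> 1 + y\<close> leads back to the power.\<close>
  have "ln ((c + t) / (1 + t)) \<le> (c + t) / (1 + t) - 1"
    using assms by (intro ln_le_minus_one) simp
  also have "\<dots> = (c - 1) / (1 + t)"
    using assms by (simp add: field_simps)
  finally have "\<gamma> * ln ((c + t) / (1 + t)) \<le> \<gamma> * ((c - 1) / (1 + t))"
    using assms by (intro mult_left_mono) auto
  moreover have "((1 + t) / (c + t)) powr \<gamma> = exp (- (\<gamma> * ln ((c + t) / (1 + t))))"
    using assms by (simp add: powr_def ln_div algebra_simps)
  ultimately show ?thesis
    using exp_ge_add_one_self[of "- (\<gamma> * ln ((c + t) / (1 + t)))"] by simp
qed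

text \<open>From \<open>exp y - 1 \<le> y * exp y\<close>, where both factors are bounded through
  \<open>a\<close>. The constant is thus uniform in all shifts \<open>c \<ge> a\<close>, which
  allows a shift containing G later on.\<close>

lemma powr_quotient_minus_one_le:
  fixes c a t \<gamma> :: real
  assumes "0 < a" "a \<le> 1" "a \<le> c" "0 \<le> t" "0 < \<gamma>"
  shows "((1 + t) / (c + t)) powr \<gamma> - 1 \<le> a powr (- \<gamma>) * \<gamma> / a / (1 + t)"
proof (cases "c \<ge> 1")
  case True
  then have "((1 + t) / (c + t)) powr \<gamma> \<le> 1"
    using assms by (intro powr_le1) auto
  then show ?thesis
    using assms by (smt (verit) divide_nonneg_nonneg mult_nonneg_nonneg powr_ge_zero)
next
  case False
  define y where "y = \<gamma> * ln ((1 + t) / (c + t))"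
  have act: "a * (1 + t) \<le> c + t"
    using mult_right_mono[of a 1 t] assms by (simp add: algebra_simps)
  have ey: "((1 + t) / (c + t)) powr \<gamma> = exp y"
    using assms False by (simp add: powr_def y_def)
  have "ln ((1 + t) / (c + t)) \<ge> 0"
    using assms False by (intro ln_ge_zero) (simp add: field_simps)
  then have "y \<ge> 0" using assms by (simp add: y_def)
  have "ln ((1 + t) / (c + t)) \<le> (1 + t) / (c + t) - 1"
    using assms by (intro ln_le_minus_one) simp
  also have "\<dots> = (1 - c) / (c + t)"
    using assms by (simp add: field_simps)
  also have "\<dots> \<le> 1 / (a * (1 + t))"
    using assms act by (intro frac_le) auto
  finally have "\<gamma> * ln ((1 + t) / (c + t)) \<le> \<gamma> * (1 / (a * (1 + t)))"
    using assms by (intro mult_left_mono) auto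
  then have y: "y \<le> \<gamma> / (a * (1 + t))"
    by (simp add: y_def)
  have "((1 + t) / (c + t)) powr \<gamma> \<le> (1 / a) powr \<gamma>"
    using assms act by (intro powr_mono2) (auto simp: field_simps)
  then have "exp y \<le> a powr (- \<gamma>)"
    using assms ey by (simp add: powr_minus powr_divide field_simps)
  have "exp y * (1 - y) \<le> exp y * exp (- y)"
    using exp_ge_add_one_self[of "- y"] by (intro mult_left_mono) auto
  then have "exp y - 1 \<le> exp y * y"
    by (simp add: algebra_simps flip: exp_add)
  also have "\<dots> \<le> a powr (- \<gamma>) * (\<gamma> / (a * (1 + t)))"
    using \<open>exp y \<le> a powr (- \<gamma>)\<close> y \<open>y \<ge> 0\<close> by (intro mult_mono) auto
  finally show ?thesis
    by (simp add: ey)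
qed

section \<open>Regularity and slopes of the flow\<close>

lemma convex_on_above_tangent:
  fixes f :: "'a::real_normed_vector \<Rightarrow> real"
  assumes f: "convex_on S f" and S: "open S" "x \<in> S" "y \<in> S"
    and f': "(f has_derivative f') (at x)"
  shows "f x + f' (y - x) \<le> f y"
proof -
  define h where "h s = f (x + s *\<^sub>R (y - x))" for s
  have "(h has_real_derivative f' (y - x)) (at 0)"
    unfolding h_def by (rule has_real_derivative_along_line) (simp add: f')
  then have "((\<lambda>s. (h s - h 0) / (s - 0)) \<longlongrightarrow> f' (y - x)) (at_right 0)"
    unfolding has_field_derivative_iff by (simp add: filterlim_at_split)
  moreover have "\<forall>\<^sub>F s in at_right 0. (h s - h 0) / (s - 0) \<le> f y - f x"
    unfolding eventually_at_right_field
  proof (intro exI[of _ 1] conjI allI impI)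
    fix s :: real assume s: "0 < s" "s < 1"
    have "h s = f ((1 - s) *\<^sub>R x + s *\<^sub>R y)"
      unfolding h_def by (rule arg_cong[of _ _ f]) (simp add: algebra_simps)
    also have "\<dots> \<le> (1 - s) * f x + s * f y"
      using s S by (intro convex_onD[OF f]) auto
    finally show "(h s - h 0) / (s - 0) \<le> f y - f x"
      using s by (simp add: h_def field_simps)
  qed simp
  ultimately have "f' (y - x) \<le> f y - f x"
    by (rule tendsto_upperbound) simp
  then show ?thesis by simp
qed

lemma convex_on_hessian_psd:
  fixes f :: "real ^ 'n \<Rightarrow> real"
  assumes "twice_differentiable_on S f" "convex_on S f" "open S" "x \<in> S"
  shows "psd (hessian f x)"
  using assms by (intro hessian_psd_of_tangent convex_on_above_tangent has_derivative_grad
      twice_differentiable_onD(1)) auto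

lemma Ck_extends_2D:
  assumes "Ck_extends 2 S f"
  shows "x \<in> S \<Longrightarrow> f differentiable (at x)"
    and "x \<in> S \<Longrightarrow> (\<lambda>z. frechet_derivative f (at z) v) differentiable (at x)"
    and "\<exists>g. continuous_on (closure S) g \<and> (\<forall>z\<in>S. g z = frechet_derivative f (at z) v)"
  using assms by (simp_all add: numeral_2_eq_2)

lemma has_derivative_slice:
  assumes "(F has_derivative F') (at (x, t))"
  shows "((\<lambda>y. F (y, t)) has_derivative (\<lambda>v. F' (v, 0))) (at x)"
proof (rule has_derivative_compose[where f = "\<lambda>y. (y, t)" and g = F and g' = F'])
  show "((\<lambda>y. (y, t)) has_derivative (\<lambda>v. (v, 0))) (at x)"
    by (auto intro!: derivative_eq_intros)
qed (fact assms)

locale flow =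
  fixes \<Omega> :: "(real ^ 'n) set" and \<alpha> \<beta> :: real and u :: "real ^ 'n \<Rightarrow> real \<Rightarrow> real"
  assumes domain: "open \<Omega>" "bounded \<Omega>" "\<Omega> \<noteq> {}"
    and exponents: "0 < \<alpha>" "0 \<le> \<beta>"
    and solution: "is_flow_solution \<Omega> \<alpha> \<beta> u"
begin

text \<open>The denominator of the equation written as a factor; G is its infimum over the domain at
  time zero.\<close>

definition slope_factor :: "real ^ 'n \<Rightarrow> real \<Rightarrow> real" where
  "slope_factor x t = (1 + (norm (grad (\<lambda>y. u y t) x))\<^sup>2) powr (- (\<alpha> * \<beta>))"

lemma closure_spacetime: "closure (\<Omega> \<times> {0::real<..}) = closure \<Omega> \<times> {0..}"
  by (simp add: closure_Times)

lemma regular: "Ck_extends 2 (\<Omega> \<times> {0<..}) (\<lambda>(x, t). u x t)"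
  using solution unfolding is_flow_solution_def Ck_on_closure_def by blast

lemma convex_domain: "convex \<Omega>"
  using solution by (auto simp: is_flow_solution_def strictly_convex_fun_on_def)

lemma strictly_convex: "0 \<le> t \<Longrightarrow> strictly_convex_fun_on \<Omega> (\<lambda>x. u x t)"
  using solution by (auto simp: is_flow_solution_def)

lemma convex: "0 \<le> t \<Longrightarrow> convex_on \<Omega> (\<lambda>x. u x t)"
  by (intro strictly_convex_fun_on_imp_convex_on strictly_convex)

lemma continuous: "continuous_on (closure \<Omega> \<times> {0..}) (\<lambda>(x, t). u x t)"
  using solution by (simp add: is_flow_solution_def Ck_on_closure_def closure_spacetime)

lemma continuous_space: "0 \<le> t \<Longrightarrow> continuous_on (closure \<Omega>) (\<lambda>x. u x t)"
  by (rule continuous_on_compose2[OF continuous, of _ "\<lambda>x. (x, t)", simplified])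
    (auto intro!: continuous_intros)

lemma continuous_time: "x \<in> closure \<Omega> \<Longrightarrow> continuous_on {0..} (\<lambda>t. u x t)"
  by (rule continuous_on_compose2[OF continuous, of _ "\<lambda>t. (x, t)", simplified])
    (auto intro!: continuous_intros)

text \<open>The boundary condition is imposed at positive times; time zero follows by
  continuity.\<close>

lemma frontier_zero:
  assumes "x \<in> frontier \<Omega>" "0 \<le> t"
  shows "u x t = 0"
proof -
  have "continuous_on {0..} (\<lambda>t. u x t)"
    using assms by (intro continuous_time) (simp add: frontier_def)
  moreover have "u x s = 0" if "s \<in> {0<..}" for s
    using solution assms(1) that unfolding is_flow_solution_def by blast
  ultimately show ?thesis
    using continuous_constant_on_closure[of "{0<..}" "\<lambda>t. u x t" 0 t] assms(2) by simp
qed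

lemma differentiable_spacetime:
  assumes "x \<in> \<Omega>" "0 < t"
  shows "(\<lambda>(x, t). u x t) differentiable (at (x, t))"
    and "(\<lambda>z. frechet_derivative (\<lambda>(x, t). u x t) (at z) v) differentiable (at (x, t))"
proof -
  have "(x, t) \<in> \<Omega> \<times> {0<..}"
    using assms by simp
  then show "(\<lambda>(x, t). u x t) differentiable (at (x, t))"
    and "(\<lambda>z. frechet_derivative (\<lambda>(x, t). u x t) (at z) v) differentiable (at (x, t))"
    using Ck_extends_2D(1,2)[OF regular] by blast+
qed

lemma has_derivative_space:
  assumes "x \<in> \<Omega>" "0 < t"
  shows "((\<lambda>y. u y t) has_derivative
     (\<lambda>v. frechet_derivative (\<lambda>(x, t). u x t) (at (x, t)) (v, 0))) (at x)"
proof -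
  have "((\<lambda>(x, t). u x t) has_derivative frechet_derivative (\<lambda>(x, t). u x t) (at (x, t))) (at (x, t))"
    using differentiable_spacetime(1)[OF assms] by (simp add: frechet_derivative_works)
  from has_derivative_slice[OF this] show ?thesis
    by simp
qed

lemma twice_differentiable:
  assumes "0 < t"
  shows "twice_differentiable_on \<Omega> (\<lambda>y. u y t)"
  unfolding twice_differentiable_on_def
proof (intro conjI ballI allI)
  fix x v assume "x \<in> \<Omega>"
  show "(\<lambda>y. u y t) differentiable (at x)"
    using has_derivative_space[OF \<open>x \<in> \<Omega>\<close> assms] by (rule differentiableI)
  define F where "F z = frechet_derivative (\<lambda>(x, t). u x t) (at z) (v, 0)" for z
  have "F differentiable (at (x, t))"
    using differentiable_spacetime(2)[OF \<open>x \<in> \<Omega>\<close> assms] by (simp add: F_def [abs_def])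
  then obtain F' where "(F has_derivative F') (at (x, t))"
    by (auto simp: differentiable_def)
  then have "((\<lambda>y. F (y, t)) has_derivative (\<lambda>w. F' (w, 0))) (at x)"
    by (rule has_derivative_slice)
  then have "((\<lambda>y. frechet_derivative (\<lambda>y. u y t) (at y) v) has_derivative (\<lambda>w. F' (w, 0))) (at x)"
  proof (rule has_derivative_transform_within_open[OF _ domain(1) \<open>x \<in> \<Omega>\<close>])
    show "F (y, t) = frechet_derivative (\<lambda>y. u y t) (at y) v" if "y \<in> \<Omega>" for y
      using frechet_derivative_at[OF has_derivative_space[OF that assms]] unfolding F_def by metis
  qed
  then show "(\<lambda>y. frechet_derivative (\<lambda>y. u y t) (at y) v) differentiable (at x)"
    by (rule differentiableI)
qed

text \<open>The equation speaks of \<open>deriv\<close>, which carries information once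
  differentiability in time is known; joint differentiability supplies it.\<close>

lemma has_derivative_time:
  assumes "x \<in> \<Omega>" "0 < t"
  shows "((\<lambda>s. u x s) has_real_derivative
     det (hessian (\<lambda>y. u y t) x) powr \<alpha> * slope_factor x t) (at t)"
proof -
  define F where "F = frechet_derivative (\<lambda>(x, t). u x t) (at (x, t))"
  have "((\<lambda>(x, t). u x t) has_derivative F) (at ((x, 0) + t *\<^sub>R (0, 1)))"
    using differentiable_spacetime(1)[OF assms] by (simp add: frechet_derivative_works F_def)
  from has_real_derivative_along_line[OF this]
  have "((\<lambda>s. u x s) has_real_derivative F (0, 1)) (at t)"
    by simp
  moreover from DERIV_imp_deriv[OF this]
  have "F (0, 1) = det (hessian (\<lambda>y. u y t) x) powr \<alpha> * slope_factor x t"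
    using solution assms by (simp add: is_flow_solution_def slope_factor_def powr_minus divide_inverse)
  ultimately show ?thesis by simp
qed

lemma slope_factor_bounds: "0 < slope_factor x t" "slope_factor x t \<le> 1"
proof -
  have "0 < 1 + (norm (grad (\<lambda>y. u y t) x))\<^sup>2"
    by (simp add: add_pos_nonneg)
  then show "0 < slope_factor x t"
    by (simp add: slope_factor_def)
  have "1 \<le> (1 + (norm (grad (\<lambda>y. u y t) x))\<^sup>2) powr (\<alpha> * \<beta>)"
    using exponents by (intro ge_one_powr_ge_zero) auto
  then show "slope_factor x t \<le> 1"
    by (simp add: slope_factor_def powr_minus inverse_le_1_iff)
qed

lemma time_increasing:
  assumes "x \<in> closure \<Omega>" "0 \<le> s" "s \<le> t"
  shows "u x s \<le> u x t"
proof (cases "x \<in> \<Omega>")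
  case True
  show ?thesis
  proof (rule DERIV_nonneg_imp_increasing_open[OF \<open>s \<le> t\<close>])
    show "\<exists>y. ((\<lambda>s. u x s) has_real_derivative y) (at r) \<and> 0 \<le> y" if "s < r" "r < t" for r
    proof (intro exI conjI)
      show "((\<lambda>s. u x s) has_real_derivative
          det (hessian (\<lambda>y. u y r) x) powr \<alpha> * slope_factor x r) (at r)"
        using that assms by (intro has_derivative_time True) simp
      show "0 \<le> det (hessian (\<lambda>y. u y r) x) powr \<alpha> * slope_factor x r"
        using slope_factor_bounds(1)[of x r] by simp
    qed
    show "continuous_on {s..t} (\<lambda>s. u x s)"
      using continuous_time[OF assms(1)] assms(2) by (rule_tac continuous_on_subset) auto
  qed
next
  case False
  then show ?thesis
    using frontier_zero[of x] assms domain by (auto simp: frontier_def interior_open)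
qed

lemma gradient_extension:
  obtains p where "continuous_on (closure \<Omega> \<times> {0..}) p"
    "\<And>x t. x \<in> \<Omega> \<Longrightarrow> 0 < t \<Longrightarrow> p (x, t) = grad (\<lambda>y. u y t) x"
proof -
  have "\<exists>g. continuous_on (closure \<Omega> \<times> {0..}) g \<and>
      (\<forall>z\<in>\<Omega> \<times> {0<..}. g z = frechet_derivative (\<lambda>(x, t). u x t) (at z) v)" for v
    using Ck_extends_2D(3)[OF regular] unfolding closure_spacetime .
  then obtain g where g: "\<And>v. continuous_on (closure \<Omega> \<times> {0..}) (g v)"
    "\<And>v z. z \<in> \<Omega> \<times> {0<..} \<Longrightarrow> g v z = frechet_derivative (\<lambda>(x, t). u x t) (at z) v"
    by metis
  show thesis
  proof (rule that[of "\<lambda>z. \<chi> i. g (axis i 1, 0) z"])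
    show "continuous_on (closure \<Omega> \<times> {0..}) (\<lambda>z. \<chi> i. g (axis i 1, 0) z)"
      by (intro continuous_on_vec_lambda g)
    show "(\<chi> i. g (axis i 1, 0) (x, t)) = grad (\<lambda>y. u y t) x" if "x \<in> \<Omega>" "0 < t" for x t
      using g(2)[of "(x, t)"] that has_derivative_imp_grad_inner[OF has_derivative_space[OF that]]
      by (simp add: vec_eq_iff inner_axis)
  qed
qed

text \<open>The gradients at times \<open>1 / (k + 1)\<close> converge uniformly, so their limit is the gradient of
  the initial value.\<close>

lemma initial_gradient:
  obtains M where "\<And>x. x \<in> \<Omega> \<Longrightarrow> (\<lambda>y. u y 0) differentiable (at x)"
    "\<And>x. x \<in> \<Omega> \<Longrightarrow> norm (grad (\<lambda>y. u y 0) x) \<le> M"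
proof -
  \<comment> \<open>Differentiability is given at positive times only, so the gradient at time zero
    has to be recovered from the continuous extension \<open>p\<close>.\<close>
  obtain p where p: "continuous_on (closure \<Omega> \<times> {0..}) p"
    "\<And>x t. x \<in> \<Omega> \<Longrightarrow> 0 < t \<Longrightarrow> p (x, t) = grad (\<lambda>y. u y t) x"
    using gradient_extension by blast
  define Q where "Q = closure \<Omega> \<times> {0..1::real}"
  have pQ: "continuous_on Q p" "compact Q"
    unfolding Q_def using domain
    by (auto intro!: continuous_on_subset[OF p(1)] compact_Times simp: compact_closure)
  have unif: "uniformly_continuous_on Q p"
    using pQ by (rule compact_uniformly_continuous)
  obtain M where M: "\<And>z. z \<in> Q \<Longrightarrow> norm (p z) \<le> M"
    using compact_imp_bounded[OF compact_continuous_image[OF pQ]] by (auto simp: bounded_iff)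
  define T where "T k = inverse (real (Suc k))" for k
  have T: "0 < T k" "T k \<le> 1" for k
    by (auto simp: T_def field_simps)
  have T0: "T \<longlonglongrightarrow> 0"
    unfolding T_def by (rule LIMSEQ_inverse_real_of_nat)
  obtain z where "z \<in> \<Omega>" using domain by blast
  have lim: "(\<lambda>k. u x (T k)) \<longlonglongrightarrow> u x 0" if "x \<in> \<Omega>" for x
  proof (rule continuous_on_tendsto_compose[OF continuous_time T0])
    show "x \<in> closure \<Omega>" using that closure_subset by blast
  qed (use T in \<open>auto simp: less_imp_le\<close>)
  have "\<exists>g. \<forall>x\<in>\<Omega>. (\<lambda>k. u x (T k)) \<longlonglongrightarrow> g x \<and> (g has_derivative (\<lambda>h. p (x, 0) \<bullet> h)) (at x within \<Omega>)"
  proof (rule has_derivative_sequence[where f = "\<lambda>k x. u x (T k)" and f' = "\<lambda>k x h. p (x, T k) \<bullet> h",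
        OF convex_domain _ _ \<open>z \<in> \<Omega>\<close> lim[OF \<open>z \<in> \<Omega>\<close>]])
    show "((\<lambda>x. u x (T k)) has_derivative (\<lambda>h. p (x, T k) \<bullet> h)) (at x within \<Omega>)" if "x \<in> \<Omega>" for k x
      using has_derivative_grad[OF twice_differentiable_onD(1)[OF twice_differentiable domain(1) that], of "T k"]
        p(2)[OF that, of "T k"] T by (simp add: has_derivative_at_withinI)
    show "\<forall>\<^sub>F k in sequentially. \<forall>x\<in>\<Omega>. \<forall>h. norm (p (x, T k) \<bullet> h - p (x, 0) \<bullet> h) \<le> e * norm h"
      if "e > 0" for e
    proof -
      obtain d where d: "d > 0" "\<And>z z'. z \<in> Q \<Longrightarrow> z' \<in> Q \<Longrightarrow> dist z' z < d \<Longrightarrow> dist (p z') (p z) < e"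
        using unif \<open>e > 0\<close> unfolding uniformly_continuous_on_def by blast
      have "\<forall>\<^sub>F k in sequentially. dist (T k) 0 < d"
        using T0 \<open>d > 0\<close> by (simp add: tendsto_iff)
      then show ?thesis
      proof eventually_elim
        case (elim k)
        show ?case
        proof (intro ballI allI)
          fix x h assume "x \<in> \<Omega>"
          then have "dist (p (x, T k)) (p (x, 0)) < e"
            using elim T[of k] closure_subset[of \<Omega>]
            by (intro d(2)) (auto simp: Q_def dist_Pair_Pair less_imp_le)
          have "norm (p (x, T k) \<bullet> h - p (x, 0) \<bullet> h) \<le> norm (p (x, T k) - p (x, 0)) * norm h"
            using Cauchy_Schwarz_ineq2[of "p (x, T k) - p (x, 0)" h] by (simp add: inner_diff_left)
          also have "\<dots> \<le> e * norm h"
            using \<open>dist (p (x, T k)) (p (x, 0)) < e\<close> by (simp add: dist_norm mult_right_mono)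
          finally show "norm (p (x, T k) \<bullet> h - p (x, 0) \<bullet> h) \<le> e * norm h" .
        qed
      qed
    qed
  qed
  then obtain g where g: "\<And>x. x \<in> \<Omega> \<Longrightarrow> (\<lambda>k. u x (T k)) \<longlonglongrightarrow> g x"
    "\<And>x. x \<in> \<Omega> \<Longrightarrow> (g has_derivative (\<lambda>h. p (x, 0) \<bullet> h)) (at x within \<Omega>)"
    by blast
  have geq: "g x = u x 0" if "x \<in> \<Omega>" for x
    using LIMSEQ_unique[OF g(1)[OF that] lim[OF that]] .
  have der: "((\<lambda>y. u y 0) has_derivative (\<lambda>h. p (x, 0) \<bullet> h)) (at x)" if "x \<in> \<Omega>" for x
  proof (rule has_derivative_transform_within_open[OF _ domain(1) that geq])
    show "(g has_derivative (\<lambda>h. p (x, 0) \<bullet> h)) (at x)"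
      using g(2)[OF that] at_within_open[OF that domain(1)] by simp
  qed
  show thesis
  proof (rule that)
    fix x assume x: "x \<in> \<Omega>"
    show "(\<lambda>y. u y 0) differentiable (at x)"
      using der[OF x] by (rule differentiableI)
    have "grad (\<lambda>y. u y 0) x = p (x, 0)"
      using has_derivative_imp_grad_inner[OF der[OF x]] vector_eq_rdot by metis
    then show "norm (grad (\<lambda>y. u y 0) x) \<le> M"
      using M[of "(x, 0)"] x closure_subset[of \<Omega>] by (auto simp: Q_def)
  qed
qed

end

text \<open>Positive definiteness passes from \<open>A\<close> to \<open>B\<close>. This form serves
  the lower barrier, where the smaller matrix is that of the barrier and the Hessian of
  \<open>u\<close> might be singular a priori.\<close>

lemma psd_det_mono_above_nonsingular:
  fixes A B :: "real ^ 'n ^ 'n"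
  assumes "transpose A = A" "transpose B = B" "psd A" "psd (B - A)" "det A \<noteq> 0"
  shows "det A \<le> det B"
proof (rule psd_det_mono[OF assms(1-4)])
  have "x = 0" if "B *v x = 0" for x
  proof (rule ccontr)
    assume "x \<noteq> 0"
    then have "0 < x \<bullet> (A *v x)"
      using assms psd_det_nonzero_imp_pos by blast
    moreover have "0 \<le> x \<bullet> ((B - A) *v x)"
      using assms(4) by (simp add: psd_def)
    ultimately show False
      using that by (simp add: matrix_vector_mult_diff_rdistrib inner_diff_right)
  qed
  then show "det B \<noteq> 0"
    using det_zero_iff_kernel by blast
qed

lemma det_scaleR:
  fixes A :: "real ^ 'n ^ 'n"
  shows "det (c *\<^sub>R A) = c ^ CARD('n) * det A"
  by (simp add: det_def prod.distrib sum_distrib_left mult_ac)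

lemma psd_scaleR: "psd A \<Longrightarrow> 0 \<le> c \<Longrightarrow> psd (c *\<^sub>R A)"
  by (simp add: psd_def flip: scaleR_matrix_vector_assoc)

text \<open>The gradient of the combination vanishes at the minimum, so the graph lies above its
  horizontal tangent plane. The coefficients cover both signs of the difference between solution and
  barrier.\<close>

lemma hessian_diff_psd_at_min:
  fixes f g :: "real ^ 'n \<Rightarrow> real"
  assumes f: "twice_differentiable_on S f" and g: "twice_differentiable_on S g"
    and S: "open S" "x \<in> S"
    and min: "\<And>y. y \<in> S \<Longrightarrow> a * f x + b * g x \<le> a * f y + b * g y"
  shows "psd (a *\<^sub>R hessian f x + b *\<^sub>R hessian g x)"
proof -
  define k where "k y = a * f y + b * g y" for y
  have k: "(k has_derivative (\<lambda>v. (a *\<^sub>R grad f y + b *\<^sub>R grad g y) \<bullet> v)) (at y)" if "y \<in> S" for y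
    unfolding k_def using that twice_differentiable_onD(1)[OF f S(1)] twice_differentiable_onD(1)[OF g S(1)]
    by (auto intro!: derivative_eq_intros has_derivative_grad simp: inner_add_left)
  have k2: "((\<lambda>z. (a *\<^sub>R grad f z + b *\<^sub>R grad g z) \<bullet> v) has_derivative
      (\<lambda>w. v \<bullet> ((a *\<^sub>R hessian f y + b *\<^sub>R hessian g y) *v w))) (at y)" if "y \<in> S" for y v
  proof -
    have "((\<lambda>z. a * (grad f z \<bullet> v) + b * (grad g z \<bullet> v)) has_derivative
      (\<lambda>w. a * (v \<bullet> (hessian f y *v w)) + b * (v \<bullet> (hessian g y *v w)))) (at y)"
      by (intro has_derivative_add has_derivative_mult_right
          twice_differentiable_onD(2)[OF f S(1) that] twice_differentiable_onD(2)[OF g S(1) that])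
    then show ?thesis
      by (simp add: inner_add_left inner_add_right matrix_vector_mult_add_rdistrib
          flip: scaleR_matrix_vector_assoc)
  qed
  have "twice_differentiable_on S k"
    unfolding twice_differentiable_on_def
  proof (intro conjI ballI allI)
    fix y v assume y: "y \<in> S"
    show "k differentiable (at y)"
      using k[OF y] by (rule differentiableI)
    have "((\<lambda>z. frechet_derivative k (at z) v) has_derivative
      (\<lambda>w. v \<bullet> ((a *\<^sub>R hessian f y + b *\<^sub>R hessian g y) *v w))) (at y)"
    proof (rule has_derivative_transform_within_open[OF k2[OF y] S(1) y])
      show "(a *\<^sub>R grad f z + b *\<^sub>R grad g z) \<bullet> v = frechet_derivative k (at z) v" if "z \<in> S" for z
        using frechet_derivative_at[OF k[OF that]] by metis
    qed
    then show "(\<lambda>y. frechet_derivative k (at y) v) differentiable (at y)"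
      by (rule differentiableI)
  qed
  moreover have "k x + grad k x \<bullet> (y - x) \<le> k y" if "y \<in> S" for y
  proof -
    have "eventually (\<lambda>y. k x \<le> k y) (at x)"
      using min S eventually_at_in_open'[OF S] unfolding k_def by (auto elim: eventually_mono)
    then have "grad k x \<bullet> v = 0" for v
      using has_derivative_local_min[OF k[OF S(2)]] has_derivative_imp_grad_inner[OF k[OF S(2)]]
      by metis
    then show ?thesis
      using min[OF that] by (simp add: k_def)
  qed
  ultimately have "psd (hessian k x)"
    by (rule hessian_psd_of_tangent[OF _ S])
  then show ?thesis
    using hessian_eqI[OF S k k2[OF S(2)]] by simp
qed

section \<open>Slopes of the solution along rays and segments to the boundary\<close>

context flow
begin

text \<open>Along the direction of the gradient the tangent at \<open>x\<close> rises by the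
  left-hand side until the exit point, where it is still at most \<open>u = 0\<close>. Any direction
  does when the gradient vanishes.\<close>

lemma exit_point:
  assumes "x \<in> \<Omega>" "0 < t"
  obtains y where "y \<in> frontier \<Omega>" "y \<noteq> x"
    "norm (grad (\<lambda>y. u y t) x) * norm (y - x) \<le> - u x t"
proof -
  define p where "p = grad (\<lambda>y. u y t) x"
  obtain l where l: "l \<noteq> 0" "p \<noteq> 0 \<Longrightarrow> l = p"
    by (metis vec_eq_iff vector_choose_size zero_le_one norm_zero zero_neq_one)
  obtain d where d: "d > 0" "x + d *\<^sub>R l \<in> frontier \<Omega>"
    using ray_to_frontier[OF domain(2) _ l(1)] assms domain(1) by (metis interior_open)
  have der: "((\<lambda>y. u y t) has_derivative (\<lambda>v. p \<bullet> v)) (at x)"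
    unfolding p_def using assms
    by (intro has_derivative_grad twice_differentiable_onD(1)[OF twice_differentiable domain(1)])
  have "u (x + d *\<^sub>R l) t - u x t - p \<bullet> (x + d *\<^sub>R l - x) \<ge> 0"
  proof (rule continuous_ge_on_closure[of \<Omega> "\<lambda>y. u y t - u x t - p \<bullet> (y - x)"])
    show "continuous_on (closure \<Omega>) (\<lambda>y. u y t - u x t - p \<bullet> (y - x))"
      using assms by (intro continuous_intros continuous_space) simp
    show "0 \<le> u y t - u x t - p \<bullet> (y - x)" if "y \<in> \<Omega>" for y
      using convex_on_above_tangent[OF convex domain(1) assms(1) that der] assms by simp
  qed (use d in \<open>simp add: frontier_def\<close>)
  moreover have "p \<bullet> (d *\<^sub>R l) = norm p * norm (d *\<^sub>R l)"
    using l(2) d(1) by (cases "p = 0") (auto simp: power2_norm_eq_inner[symmetric] power2_eq_square)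
  ultimately have "norm p * norm (x + d *\<^sub>R l - x) \<le> - u x t"
    using frontier_zero[OF d(2), of t] assms by simp
  then show thesis
    using that[of "x + d *\<^sub>R l"] d l by (simp add: p_def)
qed

text \<open>The mean value theorem on the segment from \<open>x\<close> to \<open>y\<close>, whose
  interior lies in the domain by convexity and whose end has value zero.\<close>

lemma initial_mean_value:
  assumes "x \<in> \<Omega>" "y \<in> frontier \<Omega>"
  obtains \<xi> where "\<xi> \<in> \<Omega>" "- u x 0 \<le> norm (grad (\<lambda>y. u y 0) \<xi>) * norm (y - x)"
proof -
  define h where "h s = u (x + s *\<^sub>R (y - x)) 0" for s
  have inner: "x + s *\<^sub>R (y - x) \<in> \<Omega>" if "0 < s" "s < 1" for s
  proof -
    have "x \<noteq> y" using assms domain by (auto simp: frontier_def interior_open)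
    then have "x + s *\<^sub>R (y - x) \<in> open_segment x y"
      using that by (auto simp: in_segment algebra_simps intro!: exI[of _ s])
    moreover have "open_segment x y \<subseteq> interior \<Omega>"
      using assms domain by (intro in_interior_closure_convex_segment convex_domain)
        (auto simp: frontier_def interior_open)
    ultimately show ?thesis
      using domain by (auto simp: interior_open)
  qed
  have "x + s *\<^sub>R (y - x) \<in> closure \<Omega>" if "s \<in> {0..1}" for s
    using that inner[of s] assms closure_subset[of \<Omega>]
    by (cases "s = 0"; cases "s = 1") (auto simp: frontier_def)
  then have "continuous_on {0..1} h"
    unfolding h_def by (intro continuous_on_compose2[OF continuous_space] continuous_intros) auto
  moreover have "(h has_derivative (\<lambda>r. r * (grad (\<lambda>y. u y 0) (x + s *\<^sub>R (y - x)) \<bullet> (y - x)))) (at s)"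
    if "0 < s" "s < 1" for s
  proof -
    obtain M where "\<And>x. x \<in> \<Omega> \<Longrightarrow> (\<lambda>y. u y 0) differentiable (at x)"
      using initial_gradient by blast
    then have "(h has_real_derivative grad (\<lambda>y. u y 0) (x + s *\<^sub>R (y - x)) \<bullet> (y - x)) (at s)"
      unfolding h_def using inner[OF that]
      by (intro has_real_derivative_along_line has_derivative_grad) auto
    then show ?thesis
      by (simp add: has_field_derivative_def mult_commute_abs)
  qed
  ultimately obtain s where s: "0 < s" "s < 1"
    "h 1 - h 0 = (1 - 0) * (grad (\<lambda>y. u y 0) (x + s *\<^sub>R (y - x)) \<bullet> (y - x))"
    using mvt[of 0 1 h "\<lambda>s r. r * (grad (\<lambda>y. u y 0) (x + s *\<^sub>R (y - x)) \<bullet> (y - x))"] by auto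
  have "- u x 0 = grad (\<lambda>y. u y 0) (x + s *\<^sub>R (y - x)) \<bullet> (y - x)"
    using s(3) frontier_zero[OF assms(2), of 0] by (simp add: h_def)
  also have "\<dots> \<le> norm (grad (\<lambda>y. u y 0) (x + s *\<^sub>R (y - x))) * norm (y - x)"
    by (rule norm_cauchy_schwarz)
  finally show thesis
    using that inner[OF s(1,2)] by blast
qed

abbreviation G :: real where "G \<equiv> G_const \<Omega> \<alpha> \<beta> (\<lambda>y. u y 0)"

lemma G_eq: "G = (INF x\<in>\<Omega>. slope_factor x 0)"
  by (simp add: G_const_def slope_factor_def)

lemma G_le: "x \<in> \<Omega> \<Longrightarrow> G \<le> slope_factor x 0"
  unfolding G_eq by (intro cINF_lower bdd_belowI[of _ 0]) (auto intro: less_imp_le slope_factor_bounds)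

lemma G_le_one: "G \<le> 1"
  using G_le slope_factor_bounds(2) domain(3) by (meson all_not_in_conv order_trans)

lemma slope_factor_ge:
  assumes "norm (grad (\<lambda>y. u y t) x) \<le> m"
  shows "(1 + m\<^sup>2) powr (- (\<alpha> * \<beta>)) \<le> slope_factor x t"
  unfolding slope_factor_def using assms exponents
  by (intro powr_mono2') (auto intro!: power_mono add_pos_nonneg)

text \<open>The initial gradient is bounded, which keeps the infimum away from zero and makes G
  usable as the speed of a barrier.\<close>

lemma G_pos: "0 < G"
proof -
  obtain M where M: "\<And>x. x \<in> \<Omega> \<Longrightarrow> norm (grad (\<lambda>y. u y 0) x) \<le> M"
    using initial_gradient by blast
  have "0 < (1 + M\<^sup>2) powr (- (\<alpha> * \<beta>))"
    using add_pos_nonneg[OF zero_less_one zero_le_power2[of M]] by simp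
  also have "\<dots> \<le> G"
    unfolding G_eq using domain(3) M by (intro cINF_greatest slope_factor_ge) auto
  finally show ?thesis .
qed

text \<open>By convexity the solution rises at least with slope \<open>|\<nabla>u|\<close> along the ray in the direction of
  the gradient up to its exit point, while it lies above the initial value.\<close>

lemma G_le_slope_factor:
  assumes "x \<in> \<Omega>" "0 < t"
  shows "G \<le> slope_factor x t"
proof -
  obtain y where y: "y \<in> frontier \<Omega>" "y \<noteq> x" "norm (grad (\<lambda>y. u y t) x) * norm (y - x) \<le> - u x t"
    using exit_point assms by blast
  obtain \<xi> where \<xi>: "\<xi> \<in> \<Omega>" "- u x 0 \<le> norm (grad (\<lambda>y. u y 0) \<xi>) * norm (y - x)"
    using initial_mean_value assms(1) y(1) by blast
  have "u x 0 \<le> u x t"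
    using assms closure_subset by (intro time_increasing) auto
  then have "norm (grad (\<lambda>y. u y t) x) * norm (y - x) \<le> norm (grad (\<lambda>y. u y 0) \<xi>) * norm (y - x)"
    using y(3) \<xi>(2) by linarith
  then have "norm (grad (\<lambda>y. u y t) x) \<le> norm (grad (\<lambda>y. u y 0) \<xi>)"
    using y(2) by simp
  then have "slope_factor \<xi> 0 \<le> slope_factor x t"
    using slope_factor_ge[of t x] by (simp add: slope_factor_def)
  then show ?thesis
    using G_le[OF \<xi>(1)] by linarith
qed

end

section \<open>Barriers\<close>

text \<open>The remainder must be free of \<open>g\<close>, which becomes the \<beta>-dependent G.
  If \<open>c \<le> g\<close>, the factor \<open>g powr (- \<gamma>)\<close> is at most
  \<open>c powr (- \<gamma>)\<close>; otherwise the shift \<open>c / g\<close> exceeds 1 and the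
  remaining quotient is at most 1.\<close>

lemma barrier_ratio_le:
  fixes c g t \<gamma> :: real
  assumes "0 < c" "c \<le> 1" "0 < g" "g \<le> 1" "0 \<le> t" "0 < \<gamma>"
  shows "((1 + t) / (c + g * t)) powr \<gamma>
     \<le> g powr (- \<gamma>) + c powr (- \<gamma>) * (c powr (- \<gamma>) * \<gamma> / c) / (1 + t)"
proof -
  define q where "q = ((1 + t) / (c / g + t)) powr \<gamma>"
  define B where "B = c powr (- \<gamma>) * \<gamma> / c / (1 + t)"
  have "0 \<le> B"
    using assms by (simp add: B_def)
  have "c \<le> c / g"
    using assms by (simp add: field_simps)
  have "c / g + t = (c + g * t) / g"
    using assms by (simp add: field_simps)
  then have "(1 + t) / (c + g * t) = inverse g * ((1 + t) / (c / g + t))"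
    using assms by simp
  then have eq: "((1 + t) / (c + g * t)) powr \<gamma> = g powr (- \<gamma>) * q"
    using assms by (simp add: q_def powr_mult powr_minus inverse_powr del: times_divide_eq_right)
  have "g powr (- \<gamma>) * (q - 1) \<le> c powr (- \<gamma>) * B"
  proof (cases "c \<le> g")
    case True
    have "q - 1 \<le> B"
      unfolding q_def B_def using assms \<open>c \<le> c / g\<close> by (intro powr_quotient_minus_one_le) auto
    moreover have "g powr (- \<gamma>) \<le> c powr (- \<gamma>)"
      using True assms by (intro powr_mono2') auto
    ultimately show ?thesis
      using \<open>0 \<le> B\<close> by (meson mult_mono' mult_left_mono mult_right_mono order_trans powr_ge_zero)
  next
    case False
    then have "1 \<le> c / g"
      using assms by simp
    then have "q \<le> 1"
      unfolding q_def using assms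
      by (intro powr_le1) (auto simp: divide_le_eq_1_pos add_pos_nonneg)
    then have "g powr (- \<gamma>) * (q - 1) \<le> 0"
      by (simp add: mult_nonneg_nonpos)
    also have "0 \<le> c powr (- \<gamma>) * B"
      using \<open>0 \<le> B\<close> by simp
    finally show ?thesis .
  qed
  then show ?thesis
    by (simp add: eq B_def algebra_simps)
qed

lemma barrier_ratio_tendsto:
  fixes c g T \<gamma> :: real
  assumes "0 < g"
  shows "((\<lambda>t. ((1 + t) / (c + g * (t - T))) powr \<gamma>) \<longlongrightarrow> g powr (- \<gamma>)) at_top"
proof -
  have "((\<lambda>t. g + (c - g * T - g) / (1 + t)) \<longlongrightarrow> g + 0) at_top"
    by (intro tendsto_intros tendsto_divide_0[OF tendsto_const] filterlim_at_top_imp_at_infinity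
        filterlim_tendsto_add_at_top[OF tendsto_const] filterlim_ident)
  moreover have "\<forall>\<^sub>F t in at_top. g + (c - g * T - g) / (1 + t) = (c + g * (t - T)) / (1 + t)"
    using eventually_gt_at_top[of 0] by eventually_elim (simp add: field_simps)
  ultimately have "((\<lambda>t. (c + g * (t - T)) / (1 + t)) \<longlongrightarrow> g) at_top"
    using tendsto_cong by force
  then have "((\<lambda>t. ((c + g * (t - T)) / (1 + t)) powr (- \<gamma>)) \<longlongrightarrow> g powr (- \<gamma>)) at_top"
    using assms by (intro tendsto_powr tendsto_const) auto
  moreover have "\<forall>\<^sub>F t in at_top. ((c + g * (t - T)) / (1 + t)) powr (- \<gamma>)
      = ((1 + t) / (c + g * (t - T))) powr \<gamma>"
    using eventually_gt_at_top[of 0] eventually_gt_at_top[of "T - c / g"]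
  proof eventually_elim
    case (elim t)
    then have "0 < c + g * (t - T)"
      using assms by (simp add: field_simps)
    then show ?case
      using elim by (simp add: powr_minus_divide powr_divide)
  qed
  ultimately show ?thesis
    using tendsto_cong by force
qed

lemma scaled_diff_bounds:
  fixes \<psi> v r a \<gamma> :: real
  assumes "0 < a" "0 < r"
  shows "a powr (- \<gamma>) * \<psi> \<le> v \<Longrightarrow> ((r / a) powr \<gamma> - 1) * \<psi> \<le> r powr \<gamma> * v - \<psi>"
    and "v \<le> a powr (- \<gamma>) * \<psi> \<Longrightarrow> r powr \<gamma> * v - \<psi> \<le> ((r / a) powr \<gamma> - 1) * \<psi>"
proof -
  have eq: "r powr \<gamma> * (a powr (- \<gamma>) * \<psi>) = (r / a) powr \<gamma> * \<psi>"
    using assms by (simp add: powr_divide powr_minus_divide)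
  show "((r / a) powr \<gamma> - 1) * \<psi> \<le> r powr \<gamma> * v - \<psi>" if "a powr (- \<gamma>) * \<psi> \<le> v"
    using mult_left_mono[OF that, of "r powr \<gamma>"] unfolding eq by (simp add: left_diff_distrib)
  show "r powr \<gamma> * v - \<psi> \<le> ((r / a) powr \<gamma> - 1) * \<psi>" if "v \<le> a powr (- \<gamma>) * \<psi>"
    using mult_left_mono[OF that, of "r powr \<gamma>"] unfolding eq by (simp add: left_diff_distrib)
qed

section \<open>Barriers built from the profile\<close>

locale flow_profile = flow \<Omega> \<alpha> \<beta> u
  for \<Omega> :: "(real ^ 'n) set" and \<alpha> \<beta> u +
  fixes \<psi> :: "real ^ 'n \<Rightarrow> real" and \<gamma> :: real
  assumes profile: "is_profile \<Omega> \<alpha> \<psi>" and supercritical: "1 < real CARD('n) * \<alpha>"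
    and \<gamma>_def: "\<gamma> = 1 / (real CARD('n) * \<alpha> - 1)"
begin

lemma \<gamma>_pos: "0 < \<gamma>"
  using supercritical by (simp add: \<gamma>_def)

text \<open>Raising the factor \<open>a powr (- \<gamma>)\<close> to the power n\<alpha> yields
  \<open>a powr (- \<gamma> - 1)\<close>, the power that time differentiation produces.\<close>

lemma \<gamma>_homogeneity: "\<gamma> * (real CARD('n) * \<alpha>) = \<gamma> + 1"
  using supercritical by (simp add: \<gamma>_def field_simps)

lemma profile_lipschitz:
  obtains L where "L-lipschitz_on (closure \<Omega>) \<psi>"
  using profile unfolding is_profile_def by blast

lemma profile_continuous: "continuous_on (closure \<Omega>) \<psi>"
  using profile_lipschitz lipschitz_on_continuous_on by blast

lemma profile_frontier: "x \<in> frontier \<Omega> \<Longrightarrow> \<psi> x = 0"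
  using profile unfolding is_profile_def by blast

lemma profile_neg: "x \<in> \<Omega> \<Longrightarrow> \<psi> x < 0"
  using profile unfolding is_profile_def by blast

lemma profile_nonpos: "x \<in> closure \<Omega> \<Longrightarrow> \<psi> x \<le> 0"
  using profile_frontier profile_neg[of x] domain(1)
  by (cases "x \<in> \<Omega>") (auto simp: frontier_def interior_open)

lemma profile_twice_differentiable: "twice_differentiable_on \<Omega> \<psi>"
proof -
  have "Ck_on (Suc (Suc 0)) \<Omega> \<psi>"
    using profile unfolding is_profile_def smooth_on_def by blast
  then show ?thesis
    by (simp add: twice_differentiable_on_def)
qed

lemma profile_convex: "convex_on \<Omega> \<psi>"
  using profile unfolding is_profile_def by (blast intro: strictly_convex_fun_on_imp_convex_on)

lemma profile_det:
  assumes "x \<in> \<Omega>"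
  shows "0 < det (hessian \<psi> x)" "det (hessian \<psi> x) powr \<alpha> = - \<psi> x * \<gamma>"
proof -
  define q where "q = - \<psi> x / \<bar>1 - real CARD('n) * \<alpha>\<bar>"
  have q: "q = - \<psi> x * \<gamma>"
    using supercritical by (simp add: q_def \<gamma>_def)
  have "0 < q"
    unfolding q using profile_neg[OF assms] \<gamma>_pos by (intro mult_pos_pos) auto
  moreover have "det (hessian \<psi> x) = q powr (1 / \<alpha>)"
    using profile assms unfolding is_profile_def q_def by blast
  ultimately show "0 < det (hessian \<psi> x)" "det (hessian \<psi> x) powr \<alpha> = - \<psi> x * \<gamma>"
    unfolding q [symmetric] using exponents(1) by (simp_all add: powr_powr)
qed

text \<open>The right-hand side is the derivative of \<open>a powr (- \<gamma>) * \<psi> x\<close>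
  with respect to \<open>a\<close>: the barrier solves its equation.\<close>

lemma barrier_det:
  assumes "x \<in> \<Omega>" "0 < a"
  shows "det (a powr (- \<gamma>) *\<^sub>R hessian \<psi> x) powr \<alpha> = - \<gamma> * a powr (- \<gamma> - 1) * \<psi> x"
proof -
  have "(a powr (- \<gamma>)) ^ CARD('n) = a powr (- \<gamma> * real CARD('n))"
    by (metis assms(2) powr_gt_zero powr_powr powr_realpow less_irrefl)
  then have "((a powr (- \<gamma>)) ^ CARD('n)) powr \<alpha> = a powr (- (\<gamma> * (real CARD('n) * \<alpha>)))"
    by (simp add: powr_powr mult.assoc)
  also have "\<dots> = a powr (- \<gamma> - 1)"
    by (simp add: \<gamma>_homogeneity)
  finally show ?thesis
    using profile_det[OF assms(1)] by (simp add: det_scaleR powr_mult)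
qed

lemma barrier_hessian:
  assumes "x \<in> \<Omega>" "0 < a"
  defines "H \<equiv> a powr (- \<gamma>) *\<^sub>R hessian \<psi> x"
  shows "transpose H = H" "psd H" "det H \<noteq> 0"
proof -
  have "transpose (hessian \<psi> x) = hessian \<psi> x"
    using profile_twice_differentiable domain(1) assms(1) by (rule hessian_symmetric)
  then show "transpose H = H"
    by (simp add: H_def transpose_def vec_eq_iff)
  have "psd (hessian \<psi> x)"
    using profile_twice_differentiable profile_convex domain(1) assms(1) by (rule convex_on_hessian_psd)
  then show "psd H"
    unfolding H_def by (rule psd_scaleR) simp
  show "det H \<noteq> 0"
    using profile_det(1)[OF assms(1)] assms(2) by (simp add: H_def det_scaleR)
qed

lemma barrier_has_derivative:
  assumes "0 < c + g * (t - T)"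
  shows "((\<lambda>t. (c + g * (t - T)) powr (- \<gamma>) * \<psi> x) has_real_derivative
     - \<gamma> * (c + g * (t - T)) powr (- \<gamma> - 1) * \<psi> x * g) (at t)"
  using assms by (auto intro!: derivative_eq_intros DERIV_fun_powr simp: algebra_simps)

lemma barrier_continuous:
  assumes "0 < c" "0 \<le> g" "0 \<le> T"
  shows "continuous_on (closure \<Omega> \<times> {T..}) (\<lambda>z. (c + g * (snd z - T)) powr (- \<gamma>) * \<psi> (fst z))"
proof -
  have "0 < c + g * (t - T)" if "T \<le> t" for t
    using assms that by (simp add: add_pos_nonneg)
  then show ?thesis
    by (intro continuous_intros continuous_on_compose2[OF profile_continuous])
      (fastforce dest: less_imp_neq)+
qed

text \<open>At a spatial minimum of the difference the Hessian of \<open>u\<close> dominates that of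
  the barrier, and the bound \<open>g\<close> on the slope factor gives a nonnegative time
  derivative. The starting time \<open>T\<close> is free to allow a late restart.\<close>

lemma lower_barrier:
  assumes "0 < c" "0 < g" "0 \<le> T"
    and slope: "\<And>x t. x \<in> \<Omega> \<Longrightarrow> T < t \<Longrightarrow> g \<le> slope_factor x t"
    and init: "\<And>x. x \<in> closure \<Omega> \<Longrightarrow> c powr (- \<gamma>) * \<psi> x \<le> u x T"
    and x: "x \<in> closure \<Omega>" "T \<le> t"
  shows "(c + g * (t - T)) powr (- \<gamma>) * \<psi> x \<le> u x t"
proof -
  define h where "h x t = u x t - (c + g * (t - T)) powr (- \<gamma>) * \<psi> x" for x t
  have "0 \<le> h x t"
  proof (rule parabolic_minimum_principle[OF domain(1,2) _ _ _ _ x])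
    have "continuous_on (closure \<Omega> \<times> {T..}) (\<lambda>(x, t). u x t)"
      using \<open>0 \<le> T\<close> by (intro continuous_on_subset[OF continuous]) auto
    then show "continuous_on (closure \<Omega> \<times> {T..}) (\<lambda>(x, t). h x t)"
      unfolding h_def case_prod_beta using assms(1-3)
      by (intro continuous_on_diff barrier_continuous) auto
    show "0 \<le> h x T" if "x \<in> closure \<Omega>" for x
      using init[OF that] by (simp add: h_def)
    show "0 \<le> h x t" if "x \<in> frontier \<Omega>" "T \<le> t" for x t
      using that \<open>0 \<le> T\<close> by (simp add: h_def frontier_zero profile_frontier)
  next
    fix x t assume xt: "x \<in> \<Omega>" "T < t" and min: "\<And>y. y \<in> \<Omega> \<Longrightarrow> h x t \<le> h y t"
    define a where "a = c + g * (t - T)"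
    have "0 < a" "0 < t"
      using assms(1-3) xt by (auto simp: a_def add_pos_nonneg)
    let ?U = "hessian (\<lambda>y. u y t) x" and ?P = "a powr (- \<gamma>) *\<^sub>R hessian \<psi> x"
    have "psd (1 *\<^sub>R ?U + (- (a powr (- \<gamma>))) *\<^sub>R hessian \<psi> x)"
      by (rule hessian_diff_psd_at_min[OF twice_differentiable[OF \<open>0 < t\<close>] profile_twice_differentiable
            domain(1) xt(1)]) (use min in \<open>simp add: h_def a_def\<close>)
    then have "psd (?U - ?P)"
      by simp
    moreover have "transpose ?U = ?U"
      using twice_differentiable[OF \<open>0 < t\<close>] domain(1) xt(1) by (rule hessian_symmetric)
    ultimately have "det ?P \<le> det ?U"
      using barrier_hessian[OF xt(1) \<open>0 < a\<close>] by (intro psd_det_mono_above_nonsingular)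
    then have "det ?P powr \<alpha> \<le> det ?U powr \<alpha>"
      using exponents(1) psd_det_nonneg[OF barrier_hessian(2)[OF xt(1) \<open>0 < a\<close>]]
      by (intro powr_mono2) auto
    then have "det ?P powr \<alpha> * g \<le> det ?U powr \<alpha> * slope_factor x t"
      using slope[OF xt] assms(2) by (intro mult_mono) auto
    then have le: "- \<gamma> * a powr (- \<gamma> - 1) * \<psi> x * g \<le> det ?U powr \<alpha> * slope_factor x t"
      unfolding barrier_det[OF xt(1) \<open>0 < a\<close>] .
    show "\<exists>D\<ge>0. ((\<lambda>s. h x s) has_real_derivative D) (at t)"
    proof (intro exI conjI)
      show "((\<lambda>s. h x s) has_real_derivative
          det ?U powr \<alpha> * slope_factor x t - (- \<gamma> * a powr (- \<gamma> - 1) * \<psi> x * g)) (at t)"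
        unfolding h_def a_def using \<open>0 < a\<close> \<open>0 < t\<close>
        by (intro DERIV_diff has_derivative_time xt(1) barrier_has_derivative) (auto simp: a_def)
    qed (use le in simp)
  qed
  then show ?thesis
    by (simp add: h_def)
qed

text \<open>The Hessians change places: the larger one, of the barrier, is nonsingular, and the
  smaller one is positive semidefinite because \<open>u\<close> is convex. A slope factor of at most
  1 gives speed 1.\<close>

lemma upper_barrier:
  assumes "0 < c"
    and init: "\<And>x. x \<in> closure \<Omega> \<Longrightarrow> u x 0 \<le> c powr (- \<gamma>) * \<psi> x"
    and x: "x \<in> closure \<Omega>" "0 \<le> t"
  shows "u x t \<le> (c + t) powr (- \<gamma>) * \<psi> x"
proof -
  define h where "h x t = (c + 1 * (t - 0)) powr (- \<gamma>) * \<psi> x - u x t" for x t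
  have "0 \<le> h x t"
  proof (rule parabolic_minimum_principle[OF domain(1,2) _ _ _ _ x])
    show "continuous_on (closure \<Omega> \<times> {0..}) (\<lambda>(x, t). h x t)"
      unfolding h_def case_prod_beta using assms(1) continuous[unfolded case_prod_beta]
      by (intro continuous_on_diff barrier_continuous) auto
    show "0 \<le> h x 0" if "x \<in> closure \<Omega>" for x
      using init[OF that] by (simp add: h_def)
    show "0 \<le> h x t" if "x \<in> frontier \<Omega>" "0 \<le> t" for x t
      using that by (simp add: h_def frontier_zero profile_frontier)
  next
    fix x t assume xt: "x \<in> \<Omega>" "0 < t" and min: "\<And>y. y \<in> \<Omega> \<Longrightarrow> h x t \<le> h y t"
    define a where "a = c + 1 * (t - 0)"
    have "0 < a"
      using assms(1) xt by (auto simp: a_def)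
    let ?U = "hessian (\<lambda>y. u y t) x" and ?P = "a powr (- \<gamma>) *\<^sub>R hessian \<psi> x"
    have "psd (a powr (- \<gamma>) *\<^sub>R hessian \<psi> x + (- 1) *\<^sub>R ?U)"
      by (rule hessian_diff_psd_at_min[OF profile_twice_differentiable twice_differentiable[OF xt(2)]
            domain(1) xt(1)]) (use min in \<open>simp add: h_def a_def\<close>)
    then have "psd (?P - ?U)"
      by simp
    moreover have "transpose ?U = ?U"
      using twice_differentiable[OF xt(2)] domain(1) xt(1) by (rule hessian_symmetric)
    moreover have "psd ?U"
      using twice_differentiable[OF xt(2)] convex[OF less_imp_le[OF xt(2)]] domain(1) xt(1)
      by (rule convex_on_hessian_psd)
    ultimately have "det ?U \<le> det ?P"
      using barrier_hessian[OF xt(1) \<open>0 < a\<close>] by (intro psd_det_mono)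
    then have "det ?U powr \<alpha> \<le> det ?P powr \<alpha>"
      using exponents(1) psd_det_nonneg[OF \<open>psd ?U\<close>] by (intro powr_mono2) auto
    then have "det ?U powr \<alpha> * slope_factor x t \<le> det ?P powr \<alpha> * 1"
      using slope_factor_bounds by (intro mult_mono) (auto intro: less_imp_le)
    then have le: "det ?U powr \<alpha> * slope_factor x t \<le> - \<gamma> * a powr (- \<gamma> - 1) * \<psi> x * 1"
      unfolding barrier_det[OF xt(1) \<open>0 < a\<close>] .
    show "\<exists>D\<ge>0. ((\<lambda>s. h x s) has_real_derivative D) (at t)"
    proof (intro exI conjI)
      show "((\<lambda>s. h x s) has_real_derivative
          - \<gamma> * a powr (- \<gamma> - 1) * \<psi> x * 1 - det ?U powr \<alpha> * slope_factor x t) (at t)"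
        unfolding h_def a_def using \<open>0 < a\<close> xt(2)
        by (intro DERIV_diff has_derivative_time xt(1) barrier_has_derivative) (auto simp: a_def)
    qed (use le in simp)
  qed
  then show ?thesis
    by (simp add: h_def)
qed

text \<open>The bounded initial gradient limits the growth of \<open>- u x 0\<close> away from the
  boundary to a linear one, while convexity of \<psi> gives it at least linear growth.\<close>

lemma initial_lower:
  obtains c where "0 < c" "c \<le> 1" "\<And>x. x \<in> closure \<Omega> \<Longrightarrow> c powr (- \<gamma>) * \<psi> x \<le> u x 0"
proof -
  obtain z where z: "z \<in> \<Omega>" using domain(3) by blast
  obtain M where M: "\<And>x. x \<in> \<Omega> \<Longrightarrow> norm (grad (\<lambda>y. u y 0) x) \<le> M"
    using initial_gradient by blast
  have "0 \<le> M"
    using M[OF z] norm_ge_zero order_trans by blast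
  have decay: "- u x 0 \<le> M * norm (y - x)" if xy: "x \<in> \<Omega>" "y \<in> frontier \<Omega>" for x y
  proof -
    obtain \<xi> where "\<xi> \<in> \<Omega>" "- u x 0 \<le> norm (grad (\<lambda>y. u y 0) \<xi>) * norm (y - x)"
      using initial_mean_value[OF xy] by blast
    then show ?thesis
      using M[of \<xi>] by (meson mult_right_mono norm_ge_zero order_trans)
  qed
  obtain K where K: "0 < K" "\<And>x. x \<in> closure \<Omega> \<Longrightarrow> K * \<psi> x \<le> u x 0"
    using linear_decay_bounded_by_convex[of \<Omega> z \<psi> "\<lambda>x. u x 0" M] domain(1,2) z profile_continuous
      profile_convex profile_frontier frontier_zero profile_neg[OF z] \<open>0 \<le> M\<close> decay
    by (metis order_refl)
  \<comment> \<open>The second entry achieves \<open>c powr (- \<gamma>) \<ge> K\<close>; the cap at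
    1 is what \<open>barrier_ratio_le\<close> asks for.\<close>
  define c where "c = min 1 (K powr (- (1 / \<gamma>)))"
  have c: "0 < c" "c \<le> 1" "c \<le> K powr (- (1 / \<gamma>))"
    using K(1) by (auto simp: c_def)
  have "K = (K powr (- (1 / \<gamma>))) powr (- \<gamma>)"
    using K(1) \<gamma>_pos by (simp add: powr_powr)
  also have "\<dots> \<le> c powr (- \<gamma>)"
    using c \<gamma>_pos by (intro powr_mono2') auto
  finally have "c powr (- \<gamma>) * \<psi> x \<le> u x 0" if "x \<in> closure \<Omega>" for x
    using mult_right_mono_neg[of K "c powr (- \<gamma>)" "\<psi> x"] profile_nonpos[OF that] K(2)[OF that] by simp
  then show thesis
    using that c by blast
qed

text \<open>The two functions swap roles: \<psi> is Lipschitz, and \<open>u\<close> at time zero is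
  the convex function, negative by strict convexity.\<close>

lemma initial_upper:
  obtains c where "1 \<le> c" "\<And>x. x \<in> closure \<Omega> \<Longrightarrow> u x 0 \<le> c powr (- \<gamma>) * \<psi> x"
proof -
  obtain z where z: "z \<in> \<Omega>" using domain(3) by blast
  obtain L where L: "L-lipschitz_on (closure \<Omega>) \<psi>"
    using profile_lipschitz by blast
  have decay: "- \<psi> x \<le> L * norm (y - x)" if xy: "x \<in> \<Omega>" "y \<in> frontier \<Omega>" for x y
    using lipschitz_onD[OF L, of y x] xy closure_subset[of \<Omega>] profile_frontier[of y]
    by (force simp: frontier_def dist_norm)
  have neg: "u z 0 < 0"
    by (rule strictly_convex_zero_frontier_neg[OF domain(1,2) continuous_space strictly_convex _ z])
      (auto simp: frontier_zero)
  obtain K where K: "0 < K" "\<And>x. x \<in> closure \<Omega> \<Longrightarrow> K * u x 0 \<le> \<psi> x"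
    using linear_decay_bounded_by_convex[of \<Omega> z "\<lambda>x. u x 0" \<psi> L] domain(1,2) z continuous_space
      convex profile_frontier frontier_zero neg lipschitz_on_nonneg[OF L] decay
    by (metis order_refl)
  define c where "c = max 1 (K powr (1 / \<gamma>))"
  have c: "1 \<le> c" "K powr (1 / \<gamma>) \<le> c"
    by (auto simp: c_def)
  have "c powr (- \<gamma>) \<le> (K powr (1 / \<gamma>)) powr (- \<gamma>)"
    using c K(1) \<gamma>_pos by (intro powr_mono2') auto
  also have "\<dots> = 1 / K"
    using K(1) \<gamma>_pos by (simp add: powr_powr powr_minus_divide)
  finally have le: "c powr (- \<gamma>) \<le> 1 / K" .
  have "u x 0 \<le> c powr (- \<gamma>) * \<psi> x" if "x \<in> closure \<Omega>" for x
  proof -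
    have "u x 0 \<le> 1 / K * \<psi> x"
      using K(2)[OF that] K(1) by (simp add: field_simps)
    then show ?thesis
      using mult_right_mono_neg[OF le profile_nonpos[OF that]] by linarith
  qed
  then show thesis
    using that c by blast
qed

section \<open>Convergence rates and the uniform limit\<close>

lemma lower_estimate:
  assumes c: "0 < c" "c \<le> 1"
    and init: "\<And>x. x \<in> closure \<Omega> \<Longrightarrow> c powr (- \<gamma>) * \<psi> x \<le> u x 0"
    and x: "x \<in> closure \<Omega>" "0 \<le> t"
  shows "(c powr (- \<gamma>) * (c powr (- \<gamma>) * \<gamma> / c) / (1 + t) + G powr (- \<gamma>) - 1) * \<psi> x
     \<le> (1 + t) powr \<gamma> * u x t - \<psi> x"
proof -
  have "(c + G * (t - 0)) powr (- \<gamma>) * \<psi> x \<le> u x t"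
    using G_pos G_le_slope_factor by (intro lower_barrier c init x) auto
  then have "(((1 + t) / (c + G * t)) powr \<gamma> - 1) * \<psi> x \<le> (1 + t) powr \<gamma> * u x t - \<psi> x"
    using c G_pos x(2) by (intro scaled_diff_bounds(1)) (auto simp: add_pos_nonneg)
  moreover have "((1 + t) / (c + G * t)) powr \<gamma>
     \<le> G powr (- \<gamma>) + c powr (- \<gamma>) * (c powr (- \<gamma>) * \<gamma> / c) / (1 + t)"
    using c G_pos G_le_one x(2) \<gamma>_pos by (rule barrier_ratio_le)
  then have "(c powr (- \<gamma>) * (c powr (- \<gamma>) * \<gamma> / c) / (1 + t) + G powr (- \<gamma>) - 1) * \<psi> x
     \<le> (((1 + t) / (c + G * t)) powr \<gamma> - 1) * \<psi> x"
    using profile_nonpos[OF x(1)] by (intro mult_right_mono_neg) auto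
  ultimately show ?thesis
    by linarith
qed

lemma upper_estimate:
  assumes c: "1 \<le> c"
    and init: "\<And>x. x \<in> closure \<Omega> \<Longrightarrow> u x 0 \<le> c powr (- \<gamma>) * \<psi> x"
    and x: "x \<in> closure \<Omega>" "0 \<le> t"
  shows "(1 + t) powr \<gamma> * u x t - \<psi> x \<le> - (\<gamma> * (c - 1)) * \<psi> x / (1 + t)"
proof -
  have "u x t \<le> (c + t) powr (- \<gamma>) * \<psi> x"
    using c by (intro upper_barrier init x) auto
  then have "(1 + t) powr \<gamma> * u x t - \<psi> x \<le> (((1 + t) / (c + t)) powr \<gamma> - 1) * \<psi> x"
    using c x(2) by (intro scaled_diff_bounds(2)) auto
  also have "\<dots> \<le> (- (\<gamma> * (c - 1) / (1 + t))) * \<psi> x"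
    using one_minus_powr_quotient_le[OF c x(2) \<gamma>_pos] profile_nonpos[OF x(1)]
    by (intro mult_right_mono_neg) auto
  finally show ?thesis by simp
qed

text \<open>At an exit point \<open>y\<close> the product of slope and distance is at most
  \<open>- u x t\<close>, hence at most \<open>\<phi> t * (- \<psi> x)\<close>, hence at most
  \<open>L * \<phi> t\<close> times the distance. The gradient is therefore bounded by
  \<open>L * \<phi> t\<close>, which tends to zero independently of \<open>x\<close>.\<close>

lemma slope_factor_lower:
  obtains b where "(b \<longlongrightarrow> 1) at_top" "\<And>x t. x \<in> \<Omega> \<Longrightarrow> 0 < t \<Longrightarrow> b t \<le> slope_factor x t"
proof -
  obtain L where L: "L-lipschitz_on (closure \<Omega>) \<psi>"
    using profile_lipschitz by blast
  obtain c where c: "0 < c" "c \<le> 1" "\<And>x. x \<in> closure \<Omega> \<Longrightarrow> c powr (- \<gamma>) * \<psi> x \<le> u x 0"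
    using initial_lower by blast
  define \<phi> where "\<phi> t = (c + G * (t - 0)) powr (- \<gamma>)" for t
  have "filterlim (\<lambda>t. c + G * (t - 0)) at_top at_top"
    by (intro filterlim_tendsto_add_at_top[OF tendsto_const] filterlim_tendsto_pos_mult_at_top[OF tendsto_const G_pos])
      (simp add: filterlim_ident)
  then have "(\<phi> \<longlongrightarrow> 0) at_top"
    unfolding \<phi>_def using \<gamma>_pos by (intro tendsto_neg_powr) auto
  then have "((\<lambda>t. (1 + (L * \<phi> t)\<^sup>2) powr (- (\<alpha> * \<beta>))) \<longlongrightarrow> (1 + (L * 0)\<^sup>2) powr (- (\<alpha> * \<beta>))) at_top"
    by (intro tendsto_powr tendsto_intros) auto
  moreover have "(1 + (L * \<phi> t)\<^sup>2) powr (- (\<alpha> * \<beta>)) \<le> slope_factor x t" if xt: "x \<in> \<Omega>" "0 < t" for x t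
  proof (rule slope_factor_ge)
    obtain y where y: "y \<in> frontier \<Omega>" "y \<noteq> x" "norm (grad (\<lambda>y. u y t) x) * norm (y - x) \<le> - u x t"
      using exit_point xt by blast
    have xcl: "x \<in> closure \<Omega>" using xt closure_subset by blast
    have "\<phi> t * \<psi> x \<le> u x t"
      unfolding \<phi>_def using G_pos G_le_slope_factor c xcl xt by (intro lower_barrier) auto
    moreover have "- \<psi> x \<le> L * norm (y - x)"
      using lipschitz_onD[OF L, of y x] xcl y(1) profile_frontier[OF y(1)]
      by (auto simp: frontier_def dist_norm)
    then have "\<phi> t * (- \<psi> x) \<le> \<phi> t * (L * norm (y - x))"
      by (intro mult_left_mono) (auto simp: \<phi>_def)
    ultimately have "norm (grad (\<lambda>y. u y t) x) * norm (y - x) \<le> L * \<phi> t * norm (y - x)"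
      using y(3) by (simp add: mult_ac)
    then show "norm (grad (\<lambda>y. u y t) x) \<le> L * \<phi> t"
      using y(2) by simp
  qed
  ultimately show thesis
    using that[of "\<lambda>t. (1 + (L * \<phi> t)\<^sup>2) powr (- (\<alpha> * \<beta>))"] by simp
qed

lemma uniform_convergence:
  "uniform_limit (closure \<Omega>) (\<lambda>t x. (1 + t) powr \<gamma> * u x t) \<psi> at_top"
proof (rule uniform_limitI)
  fix e :: real assume "0 < e"
  have "compact (closure \<Omega>)" using domain(2) by (simp add: compact_closure)
  then obtain B where B: "0 < B" "\<And>x. x \<in> closure \<Omega> \<Longrightarrow> \<bar>\<psi> x\<bar> \<le> B"
    using compact_imp_bounded[OF compact_continuous_image[OF profile_continuous]]
    by (auto simp: bounded_pos)
  \<comment> \<open>The scaled barrier tends to \<open>1 + \<epsilon>\<close> times \<psi> and is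
    eventually within \<open>2 * \<epsilon>\<close>; the divisor 3 keeps
    \<open>2 * \<epsilon> * B\<close> below \<open>e\<close>.\<close>
  define \<epsilon> where "\<epsilon> = e / (3 * B)"
  have "0 < \<epsilon>" "2 * \<epsilon> * B < e"
    using \<open>0 < e\<close> B(1) by (auto simp: \<epsilon>_def)
  define g where "g = (1 + \<epsilon>) powr (- (1 / \<gamma>))"
  have g: "0 < g" "g powr (- \<gamma>) = 1 + \<epsilon>"
    using \<open>0 < \<epsilon>\<close> \<gamma>_pos by (auto simp: g_def powr_powr)
  have "g < 1"
    unfolding g_def using \<open>0 < \<epsilon>\<close> \<gamma>_pos by (intro powr_less_one) auto
  obtain b where b: "(b \<longlongrightarrow> 1) at_top" "\<And>x t. x \<in> \<Omega> \<Longrightarrow> 0 < t \<Longrightarrow> b t \<le> slope_factor x t"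
    using slope_factor_lower by blast
  have "\<forall>\<^sub>F t in at_top. g < b t"
    using order_tendstoD(1)[OF b(1) \<open>g < 1\<close>] .
  then obtain T0 where T0: "\<And>t. T0 \<le> t \<Longrightarrow> g < b t"
    by (auto simp: eventually_at_top_linorder)
  define T where "T = max 0 T0"
  obtain c where c: "0 < c" "c \<le> 1" "\<And>x. x \<in> closure \<Omega> \<Longrightarrow> c powr (- \<gamma>) * \<psi> x \<le> u x 0"
    using initial_lower by blast
  have lower: "(c + g * (t - T)) powr (- \<gamma>) * \<psi> x \<le> u x t" if "x \<in> closure \<Omega>" "T \<le> t" for x t
  proof (rule lower_barrier[OF c(1) g(1) _ _ _ that])
    show "0 \<le> T" by (simp add: T_def)
    show "g \<le> slope_factor x t" if "x \<in> \<Omega>" "T < t" for x t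
      using T0[of t] b(2)[of x t] that by (auto simp: T_def)
    \<comment> \<open>The constant from time zero still works at \<open>T\<close>, since
      \<open>u\<close> has only increased.\<close>
    show "c powr (- \<gamma>) * \<psi> x \<le> u x T" if "x \<in> closure \<Omega>" for x
      using c(3)[OF that] time_increasing[OF that, of 0 T] by (simp add: T_def)
  qed
  obtain d where d: "1 \<le> d" "\<And>x. x \<in> closure \<Omega> \<Longrightarrow> u x 0 \<le> d powr (- \<gamma>) * \<psi> x"
    using initial_upper by blast
  have "\<forall>\<^sub>F t in at_top. ((1 + t) / (c + g * (t - T))) powr \<gamma> < 1 + 2 * \<epsilon>"
    using order_tendstoD(2)[OF barrier_ratio_tendsto[OF g(1), of c T \<gamma>]] g(2) \<open>0 < \<epsilon>\<close> by simp
  moreover have "((\<lambda>t. \<gamma> * (d - 1) * B / (1 + t)) \<longlongrightarrow> 0) at_top"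
    by (intro tendsto_divide_0[OF tendsto_const] filterlim_at_top_imp_at_infinity
        filterlim_tendsto_add_at_top[OF tendsto_const] filterlim_ident)
  then have "\<forall>\<^sub>F t in at_top. \<gamma> * (d - 1) * B / (1 + t) < e"
    using order_tendstoD(2) \<open>0 < e\<close> by blast
  ultimately show "\<forall>\<^sub>F t in at_top. \<forall>x\<in>closure \<Omega>. dist ((1 + t) powr \<gamma> * u x t) (\<psi> x) < e"
    using eventually_ge_at_top[of T]
  proof eventually_elim
    case (elim t)
    have "0 \<le> t" using elim(3) by (simp add: T_def)
    show ?case
    proof
      fix x assume x: "x \<in> closure \<Omega>"
      have \<psi>: "\<psi> x \<le> 0" "- \<psi> x \<le> B"
        using profile_nonpos[OF x] B(2)[OF x] by auto
      have "2 * \<epsilon> * \<psi> x \<le> (((1 + t) / (c + g * (t - T))) powr \<gamma> - 1) * \<psi> x"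
        using elim(1) \<psi>(1) by (intro mult_right_mono_neg) auto
      also have "\<dots> \<le> (1 + t) powr \<gamma> * u x t - \<psi> x"
        using c(1) g(1) elim(3) \<open>0 \<le> t\<close>
        by (intro scaled_diff_bounds(1) lower x) (auto simp: add_pos_nonneg)
      finally have "2 * \<epsilon> * \<psi> x \<le> (1 + t) powr \<gamma> * u x t - \<psi> x" .
      moreover have "- (2 * \<epsilon> * \<psi> x) \<le> 2 * \<epsilon> * B"
        using mult_left_mono[OF \<psi>(2), of "2 * \<epsilon>"] \<open>0 < \<epsilon>\<close> by simp
      moreover have "(1 + t) powr \<gamma> * u x t - \<psi> x \<le> - (\<gamma> * (d - 1)) * \<psi> x / (1 + t)"
        using d x \<open>0 \<le> t\<close> by (rule upper_estimate)
      moreover have "- (\<gamma> * (d - 1)) * \<psi> x / (1 + t) \<le> \<gamma> * (d - 1) * B / (1 + t)"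
        using mult_left_mono[OF \<psi>(2), of "\<gamma> * (d - 1)"] d(1) \<gamma>_pos \<open>0 \<le> t\<close>
        by (intro divide_right_mono) auto
      ultimately show "dist ((1 + t) powr \<gamma> * u x t) (\<psi> x) < e"
        using elim(2) \<open>2 * \<epsilon> * B < e\<close> unfolding dist_real_def by linarith
    qed
  qed
qed

end

section \<open>Constants common to all \<beta> and all solutions with the given initial
  values\<close>

theorem theorem2p2:
  fixes \<Omega> :: "(real ^ 'n) set" and \<alpha> :: real
    and \<psi> u0 :: "real ^ 'n \<Rightarrow> real"
  assumes "CARD('n) \<ge> 2"
    and "smooth_strictly_convex_domain \<Omega>"
    and "\<alpha> > 1 / real CARD('n)"
    and "is_profile \<Omega> \<alpha> \<psi>"
  shows
    "(\<exists>C1>0. \<forall>u. is_flow_solution \<Omega> \<alpha> 0 u \<and> (\<forall>x\<in>closure \<Omega>. u x 0 = u0 x) \<longrightarrow>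
        (\<forall>t\<ge>0. (SUP x\<in>\<Omega>. \<bar>(1 + t) powr (1 / (real CARD('n) * \<alpha> - 1)) * u x t - \<psi> x\<bar>)
                 \<le> C1 / (1 + t))) \<and>
     (\<exists>C2>0. \<exists>C3>0. \<forall>\<beta>>0. \<forall>u.
        is_flow_solution \<Omega> \<alpha> \<beta> u \<and> (\<forall>x\<in>closure \<Omega>. u x 0 = u0 x) \<longrightarrow>
        (\<forall>x\<in>closure \<Omega>. \<forall>t\<ge>0.
           (C2 / (1 + t)
             + G_const \<Omega> \<alpha> \<beta> (\<lambda>y. u y 0) powr (1 / (1 - real CARD('n) * \<alpha>)) - 1) * \<psi> x
             \<le> (1 + t) powr (1 / (real CARD('n) * \<alpha> - 1)) * u x t - \<psi> x \<and>
           (1 + t) powr (1 / (real CARD('n) * \<alpha> - 1)) * u x t - \<psi> x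
             \<le> - C3 * \<psi> x / (1 + t))) \<and>
     (\<forall>\<beta>\<ge>0. \<forall>u.
        is_flow_solution \<Omega> \<alpha> \<beta> u \<and> (\<forall>x\<in>closure \<Omega>. u x 0 = u0 x) \<longrightarrow>
        uniform_limit (closure \<Omega>)
          (\<lambda>t x. (1 + t) powr (1 / (real CARD('n) * \<alpha> - 1)) * u x t) \<psi> at_top)"
proof -
  define \<gamma> where "\<gamma> = 1 / (real CARD('n) * \<alpha> - 1)"
  define sol where "sol \<beta> u \<longleftrightarrow> is_flow_solution \<Omega> \<alpha> \<beta> u \<and> (\<forall>x\<in>closure \<Omega>. u x 0 = u0 x)"
    for \<beta> and u :: "real ^ 'n \<Rightarrow> real \<Rightarrow> real"
  have supercritical: "1 < real CARD('n) * \<alpha>"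
    using assms(3) by (simp add: field_simps)
  then have "0 < \<alpha>"
    using assms(3) by (meson divide_nonneg_nonneg le_less_trans of_nat_0_le_iff zero_le_one)
  have "0 < \<gamma>"
    using supercritical by (simp add: \<gamma>_def)
  have exponent: "1 / (1 - real CARD('n) * \<alpha>) = - \<gamma>"
    using supercritical by (simp add: \<gamma>_def field_simps)
  have flow: "flow_profile \<Omega> \<alpha> \<beta> u \<psi> \<gamma>" if "sol \<beta> u" "0 \<le> \<beta>" for \<beta> u
    using assms(2,4) that supercritical \<open>0 < \<alpha>\<close> \<gamma>_def
    unfolding sol_def smooth_strictly_convex_domain_def by unfold_locales blast+
  have "\<Omega> \<noteq> {}"
    using assms(2) by (simp add: smooth_strictly_convex_domain_def)
  \<comment> \<open>\<open>limit\<close> below shares its premises with pointwise claims, so it will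
    need some point to be instantiated with.\<close>
  then obtain z where z: "z \<in> closure \<Omega>"
    using closure_subset by blast
  \<comment> \<open>\<open>c\<close> and \<open>d\<close> have to be fixed before \<beta> and
    \<open>u\<close>. Any one solution provides them, as the inequalities mention \<open>u0\<close>
    only; if there is none, the implication is vacuous.\<close>
  have "\<exists>c d. 0 < c \<and> c \<le> 1 \<and> 1 \<le> d \<and> (\<forall>x\<in>closure \<Omega>.
      (\<exists>\<beta>\<ge>0. \<exists>u. sol \<beta> u) \<longrightarrow> c powr (- \<gamma>) * \<psi> x \<le> u0 x \<and> u0 x \<le> d powr (- \<gamma>) * \<psi> x)"
  proof (cases "\<exists>\<beta>\<ge>0. \<exists>u. sol \<beta> u")
    case True
    then obtain \<beta> u where u: "sol \<beta> u" "0 \<le> \<beta>" by blast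
    interpret flow_profile \<Omega> \<alpha> \<beta> u \<psi> \<gamma> using flow[OF u] .
    obtain c d where "0 < c" "c \<le> 1" "1 \<le> d"
      "\<And>x. x \<in> closure \<Omega> \<Longrightarrow> c powr (- \<gamma>) * \<psi> x \<le> u x 0"
      "\<And>x. x \<in> closure \<Omega> \<Longrightarrow> u x 0 \<le> d powr (- \<gamma>) * \<psi> x"
      using initial_lower initial_upper by metis
    then show ?thesis
      using u(1) unfolding sol_def by metis
  next
    case False
    then show ?thesis
      by (intro exI[of _ 1]) auto
  qed
  then obtain c d where c: "0 < c" "c \<le> 1" and d: "1 \<le> d"
    and init: "\<And>\<beta> u x. sol \<beta> u \<Longrightarrow> 0 \<le> \<beta> \<Longrightarrow> x \<in> closure \<Omega> \<Longrightarrow>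
      c powr (- \<gamma>) * \<psi> x \<le> u x 0 \<and> u x 0 \<le> d powr (- \<gamma>) * \<psi> x"
    unfolding sol_def by metis
  define C2 where "C2 = c powr (- \<gamma>) * (c powr (- \<gamma>) * \<gamma> / c)"
  \<comment> \<open>The summand 1 keeps \<open>C3\<close> positive when
    \<open>d = 1\<close>.\<close>
  define C3 where "C3 = \<gamma> * (d - 1) + 1"
  have "0 < C2" "0 < C3"
    using c d \<open>0 < \<gamma>\<close> by (auto simp: C2_def C3_def add_nonneg_pos)
  have lower: "(C2 / (1 + t) + G_const \<Omega> \<alpha> \<beta> (\<lambda>y. u y 0) powr (- \<gamma>) - 1) * \<psi> x
      \<le> (1 + t) powr \<gamma> * u x t - \<psi> x"
    and upper: "(1 + t) powr \<gamma> * u x t - \<psi> x \<le> - C3 * \<psi> x / (1 + t)"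
    and limit: "uniform_limit (closure \<Omega>) (\<lambda>t x. (1 + t) powr \<gamma> * u x t) \<psi> at_top"
    and nonpos: "\<psi> x \<le> 0"
    if u: "sol \<beta> u" "0 \<le> \<beta>" and x: "x \<in> closure \<Omega>" "0 \<le> t" for \<beta> u x t
  proof -
    interpret flow_profile \<Omega> \<alpha> \<beta> u \<psi> \<gamma> using flow[OF u] .
    show "(C2 / (1 + t) + G_const \<Omega> \<alpha> \<beta> (\<lambda>y. u y 0) powr (- \<gamma>) - 1) * \<psi> x
      \<le> (1 + t) powr \<gamma> * u x t - \<psi> x"
      using lower_estimate[OF c _ x] init[OF u] unfolding C2_def by blast
    show "\<psi> x \<le> 0"
      by (rule profile_nonpos[OF x(1)])
    then have "- (\<gamma> * (d - 1)) * \<psi> x / (1 + t) \<le> - C3 * \<psi> x / (1 + t)"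
      using x(2) by (intro divide_right_mono mult_right_mono_neg) (auto simp: C3_def)
    then show "(1 + t) powr \<gamma> * u x t - \<psi> x \<le> - C3 * \<psi> x / (1 + t)"
      using upper_estimate[OF d _ x] init[OF u] by (meson order_trans)
    show "uniform_limit (closure \<Omega>) (\<lambda>t x. (1 + t) powr \<gamma> * u x t) \<psi> at_top"
      using uniform_convergence .
  qed
  obtain L where "L-lipschitz_on (closure \<Omega>) \<psi>"
    using assms(4) unfolding is_profile_def by blast
  moreover have "bounded \<Omega>"
    using assms(2) by (simp add: smooth_strictly_convex_domain_def)
  ultimately have "bounded (\<psi> ` closure \<Omega>)"
    by (intro compact_imp_bounded compact_continuous_image)
      (auto intro: lipschitz_on_continuous_on simp: compact_closure)
  then obtain B where B: "0 < B" "\<And>x. x \<in> closure \<Omega> \<Longrightarrow> \<bar>\<psi> x\<bar> \<le> B"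
    by (auto simp: bounded_pos)
  \<comment> \<open>For \<beta> = 0 the offset in the lower bound disappears, so both bounds are
    multiples of \<open>\<psi> x / (1 + t)\<close> and a bound \<open>B\<close> on \<psi> gives the
    supremum estimate.\<close>
  have G0: "G_const \<Omega> \<alpha> 0 v = 1" for v
  proof -
    have "1 + (norm (grad v x))\<^sup>2 \<noteq> 0" for x
      by (smt (verit) zero_le_power2)
    then show ?thesis
      using \<open>\<Omega> \<noteq> {}\<close> by (simp add: G_const_def)
  qed
  have sup: "(SUP x\<in>\<Omega>. \<bar>(1 + t) powr \<gamma> * u x t - \<psi> x\<bar>) \<le> (C2 + C3) * B / (1 + t)"
    if u: "sol 0 u" and t: "0 \<le> t" for u t
  proof (rule cSUP_least[OF \<open>\<Omega> \<noteq> {}\<close>])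
    fix x assume "x \<in> \<Omega>"
    then have x: "x \<in> closure \<Omega>" using closure_subset by blast
    have \<psi>: "- \<psi> x \<le> B" "0 \<le> - \<psi> x"
      using B(2)[OF x] nonpos[OF u _ x t] by auto
    have le: "a * (- \<psi> x) / (1 + t) \<le> (C2 + C3) * B / (1 + t)" if "0 \<le> a" "a \<le> C2 + C3" for a
      using that \<psi> t by (intro divide_right_mono mult_mono) auto
    show "\<bar>(1 + t) powr \<gamma> * u x t - \<psi> x\<bar> \<le> (C2 + C3) * B / (1 + t)"
      using lower[OF u _ x t] upper[OF u _ x t] le[of C2] le[of C3] \<open>0 < C2\<close> \<open>0 < C3\<close>
      by (simp add: G0 abs_le_iff)
  qed
  show ?thesis
    unfolding exponent \<gamma>_def[symmetric] sol_def[symmetric]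
  proof (intro conjI)
    show "\<exists>C1>0. \<forall>u. sol 0 u \<longrightarrow>
        (\<forall>t\<ge>0. (SUP x\<in>\<Omega>. \<bar>(1 + t) powr \<gamma> * u x t - \<psi> x\<bar>) \<le> C1 / (1 + t))"
      using sup \<open>0 < C2\<close> \<open>0 < C3\<close> B(1) by (intro exI[of _ "(C2 + C3) * B"]) auto
    show "\<exists>C2>0. \<exists>C3>0. \<forall>\<beta>>0. \<forall>u. sol \<beta> u \<longrightarrow> (\<forall>x\<in>closure \<Omega>. \<forall>t\<ge>0.
        (C2 / (1 + t) + G_const \<Omega> \<alpha> \<beta> (\<lambda>y. u y 0) powr (- \<gamma>) - 1) * \<psi> x
          \<le> (1 + t) powr \<gamma> * u x t - \<psi> x \<and>
        (1 + t) powr \<gamma> * u x t - \<psi> x \<le> - C3 * \<psi> x / (1 + t))"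
      using lower upper \<open>0 < C2\<close> \<open>0 < C3\<close> less_imp_le by blast
    show "\<forall>\<beta>\<ge>0. \<forall>u. sol \<beta> u \<longrightarrow>
        uniform_limit (closure \<Omega>) (\<lambda>t x. (1 + t) powr \<gamma> * u x t) \<psi> at_top"
      using limit[OF _ _ z order_refl] by blast
  qed
qed

end
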